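(* Consider the $k$-agent competitive secretary game with deferred selections and random tie-breaking with $n\ge k$ awards (defined in the context), and let $y_i$ denote the $i$-th largest award value. Let $S=(\sigma_1,\dots,\sigma_k)$ be the profile in which every agent $i$ plays the strategy $\sigma_i$ defined in the context. Then the expected sum of the awards allocated under $S$ is at least $\frac{k-1}{k}\sum_{i=1}^k y_i$.
   Context: Game: there are $n$ non-negative real awards, unknown in advance, revealed one per time step in a uniformly random order; $v_t$ is the award revealed at time $t$. There are $k$ agents. Upon the revelation of $v_t$, every agent that has not yet received an award (an active agent) may select one of the awards among $v_1,\dots,v_t$ that have not yet been assigned (available awards), or pass. An award selected by a single agent is assigned to that agent; an award selected by several agents is assigned to one of them chosen uniformly at random. Agents that received an award become inactive and assigned awards become unavailable. If after time $n$ active agents remain, they continue competing (with no new arrivals) over the remaining available awards until all agents are allocated. Strategy $\sigma_i$: let $\ell_t$ be the number of active agents at time $t$ (including $i$). If $t\ge n$, select the maximal available award. If $n/\ell_t<t<n$ and the maximal award among $v_1,\dots,v_t$ is available, select it. If $t=n/2$, $\ell_t=2$ and the maximal award so far is available, select it. Otherwise pass. *)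

theory Defs
  imports "HOL-Probability.Probability" "HOL-Combinatorics.Permutations"
begin

(* Awards are identified by their arrival time s \<in> {1..n}; w s is the value revealed at time s.
   A strategy receives: n, the current time t, the number l of active agents (incl. itself),
   the revealed values (w restricted to times \<le> min t n), and the set of available awards;
   it returns Some s (select award s) or None (pass). *)
type_synonym strategy = "nat \<Rightarrow> nat \<Rightarrow> nat \<Rightarrow> (nat \<Rightarrow> real) \<Rightarrow> nat set \<Rightarrow> nat option"

(* state: (set of active agents, set of assigned awards, allocation agent \<mapsto> award) *)
type_synonym state = "nat set \<times> nat set \<times> (nat \<Rightarrow> nat option)"

definition best :: "(nat \<Rightarrow> real) \<Rightarrow> nat set \<Rightarrow> nat" where
  "best vals X = Min {s \<in> X. \<forall>u\<in>X. vals u \<le> vals s}"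

definition sigma :: strategy where
  "sigma n t l vals avail =
     (if n \<le> t then (if avail = {} then None else Some (best vals avail))
      else if (real n / real l < real t \<and> t < n) \<or> (real t = real n / 2 \<and> l = 2)
      then (if best vals {1..t} \<in> avail then Some (best vals {1..t}) else None)
      else None)"

definition revealed :: "nat \<Rightarrow> nat \<Rightarrow> (nat \<Rightarrow> real) \<Rightarrow> nat \<Rightarrow> real" where
  "revealed n t w = (\<lambda>s. if 1 \<le> s \<and> s \<le> min t n then w s else 0)"

definition game_step :: "(nat \<Rightarrow> strategy) \<Rightarrow> (nat \<Rightarrow> real) \<Rightarrow> nat \<Rightarrow> nat \<Rightarrow> state \<Rightarrow> state pmf" where
  "game_step S w n t st =
    (case st of (act, asg, alloc) \<Rightarrow>
      let avail = {1..min t n} - asg;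
          l = card act;
          c = (\<lambda>i. if i \<in> act then
                     (case S i n t l (revealed n t w) avail of
                        None \<Rightarrow> None
                      | Some a \<Rightarrow> if a \<in> avail then Some a else None)
                   else None);
          sel = {a. \<exists>i\<in>act. c i = Some a}
      in map_pmf
           (\<lambda>win. let got = (\<lambda>i. c i \<noteq> None \<and> win (the (c i)) = i)
                  in ({i \<in> act. \<not> got i}, asg \<union> sel,
                      (\<lambda>i. if i \<in> act \<and> got i then c i else alloc i)))
           (Pi_pmf sel 0 (\<lambda>a. pmf_of_set {i \<in> act. c i = Some a})))"

fun game_run :: "(nat \<Rightarrow> strategy) \<Rightarrow> (nat \<Rightarrow> real) \<Rightarrow> nat \<Rightarrow> nat \<Rightarrow> state \<Rightarrow> state pmf" where
  "game_run S w n 0 st = return_pmf st"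
| "game_run S w n (Suc t) st = game_run S w n t st \<bind> game_step S w n (Suc t)"

definition init_state :: "nat \<Rightarrow> state" where
  "init_state k = ({0..<k}, {}, (\<lambda>_. None))"

definition total_award :: "nat \<Rightarrow> (nat \<Rightarrow> real) \<Rightarrow> state \<Rightarrow> real" where
  "total_award k w st = (\<Sum>i<k. case snd (snd st) i of None \<Rightarrow> 0 | Some a \<Rightarrow> w a)"

(* distribution of the total allocated value: awards v 0, ..., v (n-1) arrive in a uniformly
   random order p (award v (p (s-1)) is revealed at time s); the game is run for times
   1..n+k (after time n at least one agent is allocated per step under sigma, so all agents are
   allocated by then; further steps with no active agents change nothing). *)
definition total_pmf :: "(nat \<Rightarrow> strategy) \<Rightarrow> nat \<Rightarrow> nat \<Rightarrow> (nat \<Rightarrow> real) \<Rightarrow> real pmf" where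
  "total_pmf S n k v =
     do { p \<leftarrow> pmf_of_set {p. p permutes {0..<n}};
          let w = (\<lambda>s. v (p (s - 1)));
          st \<leftarrow> game_run S w n (n + k) (init_state k);
          return_pmf (total_award k w st) }"

definition top_sum :: "nat \<Rightarrow> nat \<Rightarrow> (nat \<Rightarrow> real) \<Rightarrow> real" where
  "top_sum n k v = (\<Sum>i<k. rev (sort (map v [0..<n])) ! i)"

end

(* A selection before time n takes the best award so far, so it wastes a place of the top h awards only if it
   happens before the first of them arrives.  Suppose the selection leaving l agents happens at time t, so that
   t >= n / (l + 1), and no top-h award has arrived yet.  A further selection before the first top-h award needs
   a new record.  The best award outside the top h is among the first t with probability at least t/n, and then
   there is no such record; hence another wasted selection follows with probability at most l / (l + 1).
   For h < k, reaching h active agents therefore costs a telescoping factor (h + 1) / k, after which the expected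
   number of records before the first top-h award is at most h / (h + 1).  So the expected number of missed
   awards among the top h is at most h / k.  For h >= k some selection is wasted with probability at most 1/2, and
   then at most one more is wasted in expectation, so the expected number of misses is at most 1.  Abel summation
   over h gives the theorem. *)
theory Submission
  imports Defs
begin

section \<open>Records in uniformly random permutations\<close>

text \<open>The times of selections depend on what a run has seen, while the chance of a further
  wasted selection concerns the future, so conditioning on the run itself is awkward. The run is
  therefore only compared with \<open>reach\<close>, a property of the set of record times alone.
  Records up to \<open>t\<close> are independent of every event that ignores the order of the first
  \<open>t\<close> arrivals (\<open>prefix_inv\<close>); avoidance of the top \<open>h\<close> up to
  \<open>t\<close> or later, and records after \<open>t\<close>, are such events. Splitting by the
  first completion time of a chain turns every conditional probability into a product of counts. The
  constants fit exactly. The first selection is not charged, so for \<open>h < k\<close> the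
  telescoping product is (h+1)/k, and its numerator cancels the denominator of h/(h+1), leaving h/k.
  For \<open>h >= k\<close> the two contributions are 1/2 each. In both cases the expected loss is
  at most the fraction 1/k of the weight \<open>min h k\<close> that level \<open>h\<close> has in
  the sum of the top \<open>k\<close>. Equal values are harmless: a level \<open>h\<close> with
  \<open>v h = v (h - 1)\<close> has weight 0 in the Abel summation, and at every other level the
  top \<open>h\<close> awards are separated from the rest by value.\<close>

definition perm_count :: "nat \<Rightarrow> ((nat \<Rightarrow> nat) \<Rightarrow> bool) \<Rightarrow> real" where
  "perm_count n P = real (card {p. p permutes {0..<n} \<and> P p})"

text \<open>Such a \<open>D\<close> may depend on the unordered set of the first \<open>t\<close>
  labels and on everything after them, but carries no information on the order of the first
  \<open>t\<close> arrivals.\<close>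

definition prefix_inv :: "nat \<Rightarrow> nat \<Rightarrow> ((nat \<Rightarrow> nat) \<Rightarrow> bool) \<Rightarrow> bool" where
  "prefix_inv n t D \<longleftrightarrow> (\<forall>p \<pi>. p permutes {0..<n} \<longrightarrow> \<pi> permutes {0..<t} \<longrightarrow> D (p \<circ> \<pi>) = D p)"

text \<open>Labels are ranks with 0 the best, so a record is a new minimum, and the labels below
  \<open>h\<close> are the top \<open>h\<close> awards. Times start at 1: time \<open>t\<close> is
  position \<open>t - 1\<close> of \<open>p\<close>.\<close>

definition record_at :: "(nat \<Rightarrow> nat) \<Rightarrow> nat \<Rightarrow> bool" where
  "record_at p t \<longleftrightarrow> 1 \<le> t \<and> (\<forall>s<t - 1. p (t - 1) < p s)"

definition avoids :: "nat \<Rightarrow> nat \<Rightarrow> (nat \<Rightarrow> nat) \<Rightarrow> bool" where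
  "avoids h t p \<longleftrightarrow> (\<forall>s<t. h \<le> p s)"

lemma finite_perms: "finite {p. p permutes {0..<n::nat} \<and> P p}"
  by (rule finite_subset[OF _ finite_permutations[of "{0..<n}"]]) auto

lemma perm_count_nonneg [simp]: "0 \<le> perm_count n P"
  by (simp add: perm_count_def)

lemma perm_count_cong:
  "(\<And>p. p permutes {0..<n} \<Longrightarrow> P p = Q p) \<Longrightarrow> perm_count n P = perm_count n Q"
  unfolding perm_count_def by (metis (mono_tags, lifting) Collect_cong)

lemma perm_count_mono:
  "(\<And>p. p permutes {0..<n} \<Longrightarrow> P p \<Longrightarrow> Q p) \<Longrightarrow> perm_count n P \<le> perm_count n Q"
  unfolding perm_count_def of_nat_le_iff by (rule card_mono[OF finite_perms]) auto

lemma perm_count_True: "perm_count n (\<lambda>_. True) = fact n"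
  using card_permutations[of "{0..<n}" n] by (simp add: perm_count_def)

lemma perm_count_False: "(\<And>p. p permutes {0..<n} \<Longrightarrow> \<not> P p) \<Longrightarrow> perm_count n P = 0"
  unfolding perm_count_def by (metis (no_types, lifting) card.empty empty_Collect_eq of_nat_0)

lemma perm_count_eq_sum:
  "perm_count n P = (\<Sum>p | p permutes {0..<n}. if P p then 1 else 0)"
  by (simp add: perm_count_def sum.If_cases finite_permutations Collect_conj_eq)

lemma perm_count_split:
  "perm_count n P = perm_count n (\<lambda>p. P p \<and> Q p) + perm_count n (\<lambda>p. P p \<and> \<not> Q p)"
  unfolding perm_count_eq_sum sum.distrib[symmetric] by (rule sum.cong) auto

lemma perm_count_partition:
  assumes "finite I" and "\<And>p. p permutes {0..<n} \<Longrightarrow> P p \<Longrightarrow> \<exists>!i. i \<in> I \<and> Q i p"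
  shows "perm_count n P = (\<Sum>i\<in>I. perm_count n (\<lambda>p. P p \<and> Q i p))"
proof -
  have "(if P p then 1 else 0) = (\<Sum>i\<in>I. if P p \<and> Q i p then 1 else 0::real)"
    if "p permutes {0..<n}" for p
  proof (cases "P p")
    case True
    from assms(2)[OF that True] obtain i where i: "i \<in> I" "Q i p" "\<And>j. j \<in> I \<Longrightarrow> Q j p \<Longrightarrow> j = i"
      by (elim ex1E) blast
    have "(\<Sum>j\<in>I. if P p \<and> Q j p then 1 else 0::real) = (\<Sum>j\<in>I. if j = i then 1 else 0)"
    proof (rule sum.cong[OF refl])
      fix j assume "j \<in> I"
      then have "Q j p \<longleftrightarrow> j = i" using i by blast
      then show "(if P p \<and> Q j p then 1 else 0::real) = (if j = i then 1 else 0)" using True by simp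
    qed
    then show ?thesis using i(1) True assms(1) by simp
  qed simp
  then have "perm_count n P = (\<Sum>p | p permutes {0..<n}. \<Sum>i\<in>I. if P p \<and> Q i p then 1 else 0)"
    unfolding perm_count_eq_sum by (intro sum.cong) simp_all
  also have "\<dots> = (\<Sum>i\<in>I. perm_count n (\<lambda>p. P p \<and> Q i p))"
    unfolding perm_count_eq_sum by (rule sum.swap)
  finally show ?thesis .
qed

section \<open>Symmetries of the uniform order and independence of records\<close>

lemma perm_count_compose_right:
  assumes "\<pi> permutes {0..<n}"
  shows "perm_count n (\<lambda>p. P (p \<circ> \<pi>)) = perm_count n P"
proof -
  have "bij_betw (\<lambda>p. p \<circ> \<pi>) {p. p permutes {0..<n} \<and> P (p \<circ> \<pi>)} {p. p permutes {0..<n} \<and> P p}"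
    using assms
    by (intro bij_betw_byWitness[where f'="\<lambda>p. p \<circ> inv \<pi>"])
       (auto simp: comp_assoc permutes_inv_o permutes_compose permutes_inv)
  then show ?thesis by (simp add: perm_count_def bij_betw_same_card)
qed

lemma perm_count_compose_left:
  assumes "\<pi> permutes {0..<n}"
  shows "perm_count n (\<lambda>p. P (\<pi> \<circ> p)) = perm_count n P"
proof -
  have "bij_betw (\<lambda>p. \<pi> \<circ> p) {p. p permutes {0..<n} \<and> P (\<pi> \<circ> p)} {p. p permutes {0..<n} \<and> P p}"
    using assms
    by (intro bij_betw_byWitness[where f'="\<lambda>p. inv \<pi> \<circ> p"])
       (auto simp: comp_assoc[symmetric] permutes_inv_o permutes_compose permutes_inv)
  then show ?thesis by (simp add: perm_count_def bij_betw_same_card)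
qed

lemma prefix_inv_mono: "prefix_inv n t D \<Longrightarrow> s \<le> t \<Longrightarrow> prefix_inv n s D"
  unfolding prefix_inv_def using permutes_subset[of _ "{0..<s}" "{0..<t}"] by auto

lemma prefix_inv_avoids: "prefix_inv n t (avoids h t)"
  unfolding prefix_inv_def
proof (intro allI impI)
  fix p \<pi> :: "nat \<Rightarrow> nat"
  assume \<pi>: "\<pi> permutes {0..<t}"
  have "(\<forall>s\<in>\<pi> ` {0..<t}. h \<le> p s) \<longleftrightarrow> (\<forall>s\<in>{0..<t}. h \<le> p (\<pi> s))" by auto
  then show "avoids h t (p \<circ> \<pi>) = avoids h t p"
    unfolding permutes_image[OF \<pi>] avoids_def by auto
qed

lemma prefix_inv_record:
  assumes "t < s"
  shows "prefix_inv n t (\<lambda>p. record_at p s)"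
  unfolding prefix_inv_def
proof (intro allI impI)
  fix p \<pi> :: "nat \<Rightarrow> nat"
  assume \<pi>: "\<pi> permutes {0..<t}"
  then have \<pi>': "\<pi> permutes {0..<s - 1}" by (rule permutes_subset) (use assms in auto)
  have fx: "\<pi> (s - 1) = s - 1" by (rule permutes_not_in[OF \<pi>']) auto
  have "(\<forall>x\<in>\<pi> ` {0..<s-1}. p (s - 1) < p x) \<longleftrightarrow> (\<forall>x\<in>{0..<s-1}. p (s-1) < p (\<pi> x))" by auto
  then show "record_at (p \<circ> \<pi>) s = record_at p s"
    unfolding permutes_image[OF \<pi>'] record_at_def using fx by auto
qed

lemma prefix_inv_conj:
  "prefix_inv n t P \<Longrightarrow> prefix_inv n t Q \<Longrightarrow> prefix_inv n t (\<lambda>p. P p \<and> Q p)"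
  by (simp add: prefix_inv_def)

lemma prefix_inv_not: "prefix_inv n t P \<Longrightarrow> prefix_inv n t (\<lambda>p. \<not> P p)"
  by (simp add: prefix_inv_def)

text \<open>Reordering the first \<open>t\<close> arrivals preserves \<open>D\<close>, so the best
  of them is equally often at each of the \<open>t\<close> positions; a record at \<open>t\<close>
  means that it is at the last one.\<close>

lemma perm_count_record:
  assumes D: "prefix_inv n t D" and t: "1 \<le> t" "t \<le> n"
  shows "perm_count n (\<lambda>p. D p \<and> record_at p t) * real t = perm_count n D"
proof -
  let ?Q = "\<lambda>s p. \<forall>s'<t. s' \<noteq> s \<longrightarrow> p s < (p s' :: nat)"
  have "perm_count n D = (\<Sum>s\<in>{0..<t}. perm_count n (\<lambda>p. D p \<and> ?Q s p))"
  proof (rule perm_count_partition)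
    fix p assume p: "p permutes {0..<n}"
    have ne: "p ` {0..<t} \<noteq> {}" "finite (p ` {0..<t})" using t by auto
    have "Min (p ` {0..<t}) \<in> p ` {0..<t}" by (rule Min_in) (use ne in auto)
    then obtain s where s: "s < t" "p s = Min (p ` {0..<t})" by auto
    have le: "p s \<le> p s'" if "s' < t" for s' using that s ne by simp
    have inj: "p a = p b \<Longrightarrow> a = b" for a b using permutes_inj[OF p] by (auto dest: injD)
    show "\<exists>!i. i \<in> {0..<t} \<and> ?Q i p"
    proof (rule ex1I[of _ s])
      show "s \<in> {0..<t} \<and> ?Q s p" using s le inj by (metis atLeastLessThan_iff le0 order_le_less)
    next
      fix i assume "i \<in> {0..<t} \<and> ?Q i p"
      then show "i = s" using le[of i] s by (metis atLeastLessThan_iff leD)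
    qed
  qed simp
  also have "\<dots> = (\<Sum>s\<in>{0..<t}. perm_count n (\<lambda>p. D p \<and> record_at p t))"
  proof (rule sum.cong[OF refl])
    fix s assume s: "s \<in> {0..<t}"
    \<comment> \<open>This swap carries the case of the minimum at position \<open>s\<close> to the
      case of a record at time \<open>t\<close>.\<close>
    let ?\<pi> = "Transposition.transpose s (t - 1)"
    have \<pi>: "?\<pi> permutes {0..<t}" using s by (intro permutes_swap_id) auto
    have \<pi>n: "?\<pi> permutes {0..<n}" using t by (intro permutes_subset[OF \<pi>]) auto
    have "perm_count n (\<lambda>p. D p \<and> ?Q s p) = perm_count n (\<lambda>p. D (p \<circ> ?\<pi>) \<and> ?Q s (p \<circ> ?\<pi>))"
      using perm_count_compose_right[OF \<pi>n, of "\<lambda>p. D p \<and> ?Q s p"] by simp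
    also have "\<dots> = perm_count n (\<lambda>p. D p \<and> record_at p t)"
    proof (rule perm_count_cong)
      fix p assume p: "p permutes {0..<n}"
      have a: "D (p \<circ> ?\<pi>) = D p" using D p \<pi> by (simp add: prefix_inv_def)
      have "?Q s (p \<circ> ?\<pi>) \<longleftrightarrow> (\<forall>s'\<in>{0..<t}. s' \<noteq> s \<longrightarrow> p (t - 1) < p (?\<pi> s'))" by auto
      also have "\<dots> \<longleftrightarrow> (\<forall>s'\<in>{0..<t}. ?\<pi> s' \<noteq> t - 1 \<longrightarrow> p (t - 1) < p (?\<pi> s'))"
        by (metis transpose_apply_first transpose_involutory)
      also have "\<dots> \<longleftrightarrow> (\<forall>x\<in>?\<pi> ` {0..<t}. x \<noteq> t - 1 \<longrightarrow> p (t - 1) < p x)" by blast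
      also have "\<dots> \<longleftrightarrow> record_at p t"
        unfolding permutes_image[OF \<pi>] record_at_def using t by (auto simp: less_diff_conv)
      finally show "(D (p \<circ> ?\<pi>) \<and> ?Q s (p \<circ> ?\<pi>)) = (D p \<and> record_at p t)" using a by simp
    qed
    finally show "perm_count n (\<lambda>p. D p \<and> ?Q s p) = perm_count n (\<lambda>p. D p \<and> record_at p t)" .
  qed
  finally show ?thesis by simp
qed

abbreviation record_set :: "nat \<Rightarrow> (nat \<Rightarrow> nat) \<Rightarrow> nat set" where
  "record_set t p \<equiv> {s\<in>{1..t}. record_at p s}"

lemma record_set_Suc:
  "record_set (Suc t) p = (if record_at p (Suc t) then insert (Suc t) (record_set t p) else record_set t p)"
  by (auto simp: le_Suc_eq)

text \<open>Independence in product form. The induction peels off the record indicator at the last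
  time: conjoining \<open>D\<close> with it, or with its negation, gives an event invariant for the
  shorter prefix, with shares 1/(t+1) and t/(t+1) of \<open>D\<close>.\<close>

lemma perm_count_indep:
  assumes "prefix_inv n t D" "t \<le> n"
  shows "perm_count n (\<lambda>p. Q (record_set t p) \<and> D p) * fact n
       = perm_count n (\<lambda>p. Q (record_set t p)) * perm_count n D"
  using assms
proof (induction t arbitrary: Q D)
  case 0
  show ?case
    by (cases "Q {}") (simp_all add: perm_count_True perm_count_False)
next
  case (Suc t)
  let ?r = "\<lambda>p. record_at p (Suc t)"
  let ?R = "record_set t"
  have split: "perm_count n (\<lambda>p. Q (record_set (Suc t) p) \<and> E p) * fact n * real (Suc t)
      = (perm_count n (\<lambda>p. Q (insert (Suc t) (?R p))) + perm_count n (\<lambda>p. Q (?R p)) * real t) * perm_count n E"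
    if E: "prefix_inv n (Suc t) E" for E
  proof -
    have e1: "prefix_inv n t (\<lambda>p. E p \<and> ?r p)" and e2: "prefix_inv n t (\<lambda>p. E p \<and> \<not> ?r p)"
      using prefix_inv_mono[OF E, of t]
      by (auto intro!: prefix_inv_conj prefix_inv_not prefix_inv_record)
    have c1: "perm_count n (\<lambda>p. E p \<and> ?r p) * real (Suc t) = perm_count n E"
      using E Suc.prems by (intro perm_count_record) auto
    have c2: "perm_count n (\<lambda>p. E p \<and> \<not> ?r p) * real (Suc t) = perm_count n E * real t"
      using c1 perm_count_split[of n E ?r] by (simp add: algebra_simps)
    have "perm_count n (\<lambda>p. Q (record_set (Suc t) p) \<and> E p)
       = perm_count n (\<lambda>p. (Q (record_set (Suc t) p) \<and> E p) \<and> ?r p)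
       + perm_count n (\<lambda>p. (Q (record_set (Suc t) p) \<and> E p) \<and> \<not> ?r p)"
      by (rule perm_count_split)
    also have "perm_count n (\<lambda>p. (Q (record_set (Suc t) p) \<and> E p) \<and> ?r p)
        = perm_count n (\<lambda>p. Q (insert (Suc t) (?R p)) \<and> E p \<and> ?r p)"
      unfolding record_set_Suc by (rule perm_count_cong) auto
    also have "perm_count n (\<lambda>p. (Q (record_set (Suc t) p) \<and> E p) \<and> \<not> ?r p)
        = perm_count n (\<lambda>p. Q (?R p) \<and> E p \<and> \<not> ?r p)"
      unfolding record_set_Suc by (rule perm_count_cong) auto
    finally have "perm_count n (\<lambda>p. Q (record_set (Suc t) p) \<and> E p) * fact n * real (Suc t)
      = perm_count n (\<lambda>p. Q (insert (Suc t) (?R p)) \<and> E p \<and> ?r p) * fact n * real (Suc t)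
      + perm_count n (\<lambda>p. Q (?R p) \<and> E p \<and> \<not> ?r p) * fact n * real (Suc t)"
      by (simp only: distrib_right)
    also have "\<dots> = perm_count n (\<lambda>p. Q (insert (Suc t) (?R p))) * (perm_count n (\<lambda>p. E p \<and> ?r p) * real (Suc t))
      + perm_count n (\<lambda>p. Q (?R p)) * (perm_count n (\<lambda>p. E p \<and> \<not> ?r p) * real (Suc t))"
      using Suc.IH[OF e1, of "\<lambda>X. Q (insert (Suc t) X)"] Suc.IH[OF e2, of Q] Suc.prems by simp
    finally show ?thesis unfolding c1 c2 by (simp add: algebra_simps)
  qed
  \<comment> \<open>In \<open>split\<close> the factor in front of the count of \<open>E\<close>
    depends on \<open>Q\<close> only; comparing \<open>E = D\<close> with the trivial event
    eliminates it.\<close>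
  have T: "prefix_inv n (Suc t) (\<lambda>_. True)" by (simp add: prefix_inv_def)
  have "perm_count n (\<lambda>p. Q (record_set (Suc t) p) \<and> D p) * fact n * real (Suc t) * fact n
    = perm_count n (\<lambda>p. Q (record_set (Suc t) p) \<and> True) * fact n * real (Suc t) * perm_count n D"
    unfolding split[OF Suc.prems(1)] split[OF T] perm_count_True by simp
  then show ?case by simp
qed

section \<open>Waiting for the first of the top h awards\<close>

lemma perm_count_avoids_Suc:
  assumes "s < n" "h \<le> n"
  shows "perm_count n (avoids h (Suc s)) * (real n - real s)
       = perm_count n (avoids h s) * (real n - real s - real h)"
proof -
  \<comment> \<open>Under avoidance, label \<open>i\<close> sits at one of the \<open>n - s\<close>
    positions from \<open>s\<close> on, equally often at each: exchanging two of these positions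
    leaves the prefix alone.\<close>
  have hit: "perm_count n (\<lambda>p. avoids h s p \<and> p s = i) * (real n - real s) = perm_count n (avoids h s)"
    if i: "i < h" for i
  proof -
    have "perm_count n (avoids h s) = (\<Sum>x\<in>{s..<n}. perm_count n (\<lambda>p. avoids h s p \<and> p x = i))"
    proof (rule perm_count_partition)
      fix p assume p: "p permutes {0..<n}" and av: "avoids h s p"
      obtain x where x: "p x = i" using permutes_surj[OF p] by (metis surjD)
      have "i \<in> {0..<n}" using i assms by simp
      then have "x \<in> {0..<n}" using permutes_in_image[OF p, of x] x by simp
      moreover have "\<not> x < s" using av i x by (auto simp: avoids_def)
      ultimately show "\<exists>!x. x \<in> {s..<n} \<and> p x = i"
        using x injD[OF permutes_inj[OF p]] by (intro ex1I[of _ x]) auto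
    qed simp
    also have "\<dots> = (\<Sum>x\<in>{s..<n}. perm_count n (\<lambda>p. avoids h s p \<and> p s = i))"
    proof (rule sum.cong[OF refl])
      fix x assume x: "x \<in> {s..<n}"
      let ?\<pi> = "Transposition.transpose x s"
      have \<pi>: "?\<pi> permutes {0..<n}" using x by (intro permutes_swap_id) auto
      have id: "?\<pi> y = y" if "y < s" for y using x that by (auto simp: Transposition.transpose_def)
      show "perm_count n (\<lambda>p. avoids h s p \<and> p x = i) = perm_count n (\<lambda>p. avoids h s p \<and> p s = i)"
        using perm_count_compose_right[OF \<pi>, of "\<lambda>p. avoids h s p \<and> p x = i"] id
        by (simp add: avoids_def)
    qed
    finally show ?thesis using assms by (simp add: of_nat_diff mult.commute)
  qed
  have "perm_count n (\<lambda>p. avoids h s p \<and> p s < h)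
      = (\<Sum>i\<in>{0..<h}. perm_count n (\<lambda>p. (avoids h s p \<and> p s < h) \<and> p s = i))"
    by (rule perm_count_partition) auto
  also have "\<dots> = (\<Sum>i\<in>{0..<h}. perm_count n (\<lambda>p. avoids h s p \<and> p s = i))"
    by (intro sum.cong refl perm_count_cong) auto
  finally have "perm_count n (\<lambda>p. avoids h s p \<and> p s < h) * (real n - real s)
      = real h * perm_count n (avoids h s)"
    using hit by (simp add: sum_distrib_right)
  moreover have "perm_count n (avoids h s)
      = perm_count n (\<lambda>p. avoids h s p \<and> p s < h) + perm_count n (\<lambda>p. avoids h s p \<and> \<not> p s < h)"
    by (rule perm_count_split)
  moreover have "(\<lambda>p. avoids h s p \<and> \<not> p s < h) = avoids h (Suc s)"
    by (auto simp: avoids_def fun_eq_iff less_Suc_eq)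
  ultimately show ?thesis by (simp add: algebra_simps)
qed

lemma perm_count_avoids_n:
  assumes "1 \<le> h" "1 \<le> n"
  shows "perm_count n (avoids h n) = 0"
proof (rule perm_count_False)
  fix p assume p: "p permutes {0..<n}"
  have "0 \<in> p ` {0..<n}" using permutes_image[OF p] assms by simp
  then show "\<not> avoids h n p" using assms by (force simp: avoids_def)
qed

text \<open>Closed form of a tail sum, by downward induction: (h+1) + (n-(t+1)-h) = n-t, the factor
  in \<open>perm_count_avoids_Suc\<close>. At \<open>t = n\<close> the right factor is negative, but
  the count is 0.\<close>

lemma sum_perm_count_avoids:
  assumes "1 \<le> h" "h \<le> n" "t \<le> n"
  shows "(\<Sum>s\<in>{t<..n}. perm_count n (avoids h s)) * (real h + 1)
       = perm_count n (avoids h t) * (real n - real t - real h)"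
  using assms(3)
proof (induction rule: inc_induct)
  case base
  show ?case using perm_count_avoids_n assms by simp
next
  case (step t)
  have "{t<..n} = insert (Suc t) {Suc t<..n}" using step by auto
  then have "(\<Sum>s\<in>{t<..n}. perm_count n (avoids h s)) * (real h + 1)
     = perm_count n (avoids h (Suc t)) * (real h + 1)
       + perm_count n (avoids h (Suc t)) * (real n - real (Suc t) - real h)"
    using step.IH by (simp add: distrib_right)
  also have "\<dots> = perm_count n (avoids h (Suc t)) * (real n - real t)"
    by (simp add: algebra_simps)
  finally show ?case using perm_count_avoids_Suc step assms by simp
qed

text \<open>In probabilities the bound is 1/(1 + h m/n). It survives the step because the true ratio
  1 - h/(n-m) is at most the ratio of consecutive bounds. It is needed for
  \<open>h * m >= n\<close>, where it gives one half.\<close>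

lemma perm_count_avoids_le:
  assumes "m \<le> n" "h \<le> n"
  shows "perm_count n (avoids h m) * (real n + real h * real m) \<le> fact n * real n"
  using assms(1)
proof (induction m)
  case 0
  have "avoids h 0 = (\<lambda>_. True)" by (auto simp: avoids_def)
  then show ?case by (simp add: perm_count_True)
next
  case (Suc m)
  let ?u = "perm_count n (avoids h m)" and ?u' = "perm_count n (avoids h (Suc m))"
  have eq: "?u' * (real n - real m) = ?u * (real n - real m - real h)"
    using Suc.prems assms by (intro perm_count_avoids_Suc) auto
  have "(real n - real m - real h) * (real n + real h * real (Suc m))
      = (real n - real m) * (real n + real h * real m) - real h * (real m + real h * real m + real h)"
    by (simp add: algebra_simps)
  also have "\<dots> \<le> (real n - real m) * (real n + real h * real m)" by simp
  finally have "?u * ((real n - real m - real h) * (real n + real h * real (Suc m)))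
     \<le> ?u * ((real n - real m) * (real n + real h * real m))"
    by (rule mult_left_mono) simp
  also have "\<dots> = (real n - real m) * (?u * (real n + real h * real m))" by simp
  also have "\<dots> \<le> (real n - real m) * (fact n * real n)"
    using Suc by (intro mult_left_mono) auto
  finally have "(real n - real m) * (?u' * (real n + real h * real (Suc m))) \<le> (real n - real m) * (fact n * real n)"
    using eq by (simp add: mult.assoc[symmetric] mult.commute[of "real n - real m" ?u'])
  then show ?case using Suc.prems by (subst (asm) mult_le_cancel_left_pos) auto
qed

text \<open>Here labels are exchanged instead of positions: swapping two labels that are both at
  least \<open>h\<close> preserves avoidance, so each position below \<open>t\<close> holds each of
  the \<open>n - h\<close> remaining labels equally often.\<close>

lemma perm_count_avoids_hit:
  assumes "h < n" "t \<le> n"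
  shows "perm_count n (\<lambda>p. avoids h t p \<and> (\<exists>s<t. p s = h)) * (real n - real h)
       = real t * perm_count n (avoids h t)"
proof -
  have hit: "perm_count n (\<lambda>p. avoids h t p \<and> p s = h) * (real n - real h) = perm_count n (avoids h t)"
    if s: "s < t" for s
  proof -
    have "perm_count n (avoids h t) = (\<Sum>x\<in>{h..<n}. perm_count n (\<lambda>p. avoids h t p \<and> p s = x))"
    proof (rule perm_count_partition)
      fix p assume p: "p permutes {0..<n}" and av: "avoids h t p"
      have "p s \<in> {0..<n}" using permutes_in_image[OF p, of s] s assms by simp
      then show "\<exists>!x. x \<in> {h..<n} \<and> p s = x"
        using av s by (auto simp: avoids_def)
    qed simp
    also have "\<dots> = (\<Sum>x\<in>{h..<n}. perm_count n (\<lambda>p. avoids h t p \<and> p s = h))"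
    proof (rule sum.cong[OF refl])
      fix x assume x: "x \<in> {h..<n}"
      let ?\<pi> = "Transposition.transpose x h"
      have \<pi>: "?\<pi> permutes {0..<n}" using x assms by (intro permutes_swap_id) auto
      have "h \<le> ?\<pi> y \<longleftrightarrow> h \<le> y" for y using x by (auto simp: Transposition.transpose_def)
      moreover have "?\<pi> y = x \<longleftrightarrow> y = h" for y by (auto simp: Transposition.transpose_def)
      ultimately show "perm_count n (\<lambda>p. avoids h t p \<and> p s = x) = perm_count n (\<lambda>p. avoids h t p \<and> p s = h)"
        using perm_count_compose_left[OF \<pi>, of "\<lambda>p. avoids h t p \<and> p s = x"]
        by (simp add: avoids_def)
    qed
    finally show ?thesis using assms by (simp add: of_nat_diff mult.commute)
  qed
  have "perm_count n (\<lambda>p. avoids h t p \<and> (\<exists>s<t. p s = h))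
      = (\<Sum>s\<in>{0..<t}. perm_count n (\<lambda>p. (avoids h t p \<and> (\<exists>s<t. p s = h)) \<and> p s = h))"
  proof (rule perm_count_partition)
    fix p assume p: "p permutes {0..<n}" and "avoids h t p \<and> (\<exists>s<t. p s = h)"
    then obtain s where "s < t" "p s = h" by auto
    then show "\<exists>!s. s \<in> {0..<t} \<and> p s = h"
      using injD[OF permutes_inj[OF p]] by (intro ex1I[of _ s]) auto
  qed simp
  also have "\<dots> = (\<Sum>s\<in>{0..<t}. perm_count n (\<lambda>p. avoids h t p \<and> p s = h))"
    by (intro sum.cong refl perm_count_cong) auto
  finally show ?thesis using hit by (simp add: sum_distrib_right)
qed

section \<open>Chains of early selections\<close>

(* Intended for R the set of record times: a selections fit into the times up to t, each preceded by a record
   later than the previous selection, where the one that leaves k - a agents happens at a time s with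
   s * (k - a + 1) >= n.  In sorted labelling every strict value record is an index record, also when values
   are tied, so this bounds the number of selections of the game from above. *)
primrec reach :: "nat \<Rightarrow> nat \<Rightarrow> nat set \<Rightarrow> nat \<Rightarrow> nat \<Rightarrow> bool" where
  "reach n k R 0 t = True"
| "reach n k R (Suc a) t = (\<exists>s' r s. s' < r \<and> r \<le> s \<and> s \<le> t \<and> r \<in> R \<and> n \<le> s * (k - a) \<and> reach n k R a s')"

text \<open>Plays the role of a stopping time: by \<open>first_reach_cong\<close> it is decided by
  the records up to \<open>t\<close>, which is what independence from \<open>prefix_inv\<close>
  events requires.\<close>

definition first_reach :: "nat \<Rightarrow> nat \<Rightarrow> nat set \<Rightarrow> nat \<Rightarrow> nat \<Rightarrow> bool" where
  "first_reach n k R a t \<longleftrightarrow> reach n k R a t \<and> (\<forall>u<t. \<not> reach n k R a u)"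

lemma reach_cong: "(\<And>r. r \<le> t \<Longrightarrow> r \<in> R \<longleftrightarrow> r \<in> R') \<Longrightarrow> reach n k R a t = reach n k R' a t"
proof (induction a arbitrary: t)
  case (Suc a)
  have "(s' < r \<and> r \<le> s \<and> s \<le> t \<and> r \<in> R \<and> n \<le> s * (k - a) \<and> reach n k R a s') \<longleftrightarrow>
        (s' < r \<and> r \<le> s \<and> s \<le> t \<and> r \<in> R' \<and> n \<le> s * (k - a) \<and> reach n k R' a s')" for s' r s
  proof (cases "s' < r \<and> r \<le> s \<and> s \<le> t")
    case True
    then have "reach n k R a s' = reach n k R' a s'" using Suc.prems by (intro Suc.IH) auto
    moreover have "r \<in> R \<longleftrightarrow> r \<in> R'" using Suc.prems True by auto
    ultimately show ?thesis by simp
  qed auto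
  then show ?case by simp
qed simp

lemma first_reach_cong:
  "(\<And>r. r \<le> t \<Longrightarrow> r \<in> R \<longleftrightarrow> r \<in> R') \<Longrightarrow> first_reach n k R a t = first_reach n k R' a t"
  unfolding first_reach_def using reach_cong[of _ R R' n k a] by (smt (verit, best) le_trans less_or_eq_imp_le)

lemma first_reach_unique: "first_reach n k R a t \<Longrightarrow> first_reach n k R a u \<Longrightarrow> t = u"
  unfolding first_reach_def by (metis linorder_neqE_nat)

lemma reach_imp_first:
  assumes "reach n k R a t"
  obtains u where "u \<le> t" "first_reach n k R a u"
proof
  show "(LEAST u. reach n k R a u) \<le> t" using assms by (rule Least_le)
  show "first_reach n k R a (LEAST u. reach n k R a u)"
    unfolding first_reach_def using assms LeastI not_less_Least by metis
qed

lemma first_reach_time: "first_reach n k R (Suc a) t \<Longrightarrow> n \<le> t * (k - a)"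
  unfolding first_reach_def by auto (meson le_trans mult_le_mono1)

text \<open>Every selection after the \<open>c\<close>-th uses a record of its own, later than the
  preceding selection; replacing the actual \<open>c\<close>-th time by the earliest possible one
  only widens the window in which these records are counted.\<close>

lemma reach_card_le:
  assumes "reach n k R a s" "c \<le> a"
  shows "\<exists>f\<le>s. first_reach n k R c f \<and> a - c \<le> card {r\<in>R. f < r \<and> r \<le> s}"
  using assms
proof (induction a arbitrary: s)
  case 0
  then show ?case using reach_imp_first[of n k R 0 s] by (metis diff_0_eq_0 le0 le_zero_eq)
next
  case (Suc a)
  show ?case
  proof (cases "c = Suc a")
    case True
    then show ?thesis using Suc.prems reach_imp_first[of n k R "Suc a" s] by (metis diff_self_eq_0 le0)
  next
    case False
    obtain s' r s0 where r: "s' < r" "r \<le> s0" "s0 \<le> s" "r \<in> R" "reach n k R a s'"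
      using Suc.prems by auto
    obtain f where f: "f \<le> s'" "first_reach n k R c f" "a - c \<le> card {r\<in>R. f < r \<and> r \<le> s'}"
      using Suc.IH[OF r(5)] False Suc.prems by auto
    have "Suc (card {r\<in>R. f < r \<and> r \<le> s'}) = card (insert r {r\<in>R. f < r \<and> r \<le> s'})"
      using r by (subst card_insert_disjoint) auto
    also have "\<dots> \<le> card {r\<in>R. f < r \<and> r \<le> s}"
      using r f by (intro card_mono) auto
    finally have "Suc a - c \<le> card {r\<in>R. f < r \<and> r \<le> s}" using f(3) by simp
    then show ?thesis using f r by (meson le_trans less_imp_le)
  qed
qed

abbreviation first_time :: "nat \<Rightarrow> nat \<Rightarrow> nat \<Rightarrow> nat \<Rightarrow> (nat \<Rightarrow> nat) \<Rightarrow> bool" where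
  "first_time n k a t p \<equiv> first_reach n k {s. record_at p s} a t"

lemma first_time_indep:
  assumes "prefix_inv n t D" "t \<le> n"
  shows "perm_count n (\<lambda>p. first_time n k a t p \<and> D p) * fact n
       = perm_count n (first_time n k a t) * perm_count n D"
proof -
  have eq: "first_time n k a t p = first_reach n k (record_set t p) a t" for p
    by (rule first_reach_cong) (auto simp: record_at_def)
  show ?thesis unfolding eq by (rule perm_count_indep[OF assms])
qed

text \<open>\<open>fact n\<close> times the probability that a chain of \<open>a\<close> selections
  is completed before any top-\<open>h\<close> award arrives. Summing over the completion time lets
  independence be applied at each time separately.\<close>

definition reach_count :: "nat \<Rightarrow> nat \<Rightarrow> nat \<Rightarrow> nat \<Rightarrow> real" where
  "reach_count n k h a = (\<Sum>t\<in>{0..n}. perm_count n (\<lambda>p. first_time n k a t p \<and> avoids h t p))"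

lemma reach_count_eq:
  "reach_count n k h a = perm_count n (\<lambda>p. \<exists>t\<in>{0..n}. first_time n k a t p \<and> avoids h t p)"
proof -
  have "perm_count n (\<lambda>p. \<exists>t\<in>{0..n}. first_time n k a t p \<and> avoids h t p)
     = (\<Sum>t\<in>{0..n}. perm_count n (\<lambda>p. (\<exists>t\<in>{0..n}. first_time n k a t p \<and> avoids h t p) \<and> first_time n k a t p \<and> avoids h t p))"
    by (rule perm_count_partition) (auto dest: first_reach_unique)
  also have "\<dots> = reach_count n k h a"
    unfolding reach_count_def by (intro sum.cong refl perm_count_cong) auto
  finally show ?thesis by simp
qed

lemma prefix_inv_avoids_later: "t \<le> s \<Longrightarrow> prefix_inv n t (avoids h s)"
  using prefix_inv_mono prefix_inv_avoids by blast

lemma perm_count_later_record: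
  assumes h: "1 \<le> h" "h \<le> n" and u: "1 \<le> u" "u \<le> n"
  shows "perm_count n (\<lambda>p. avoids h u p \<and> (\<exists>r\<in>{u<..n}. record_at p r \<and> avoids h r p)) * real n
       \<le> perm_count n (avoids h u) * (real n - real u)"
\<comment> \<open>With \<open>h = n\<close> there is no best award outside the top \<open>h\<close>;
  then a nonempty prefix cannot avoid the top \<open>h\<close>.\<close>
proof (cases "h = n")
  case True
  have "p 0 < n" if "p permutes {0..<n}" for p
    using permutes_in_image[OF that, of 0] u by simp
  then have "perm_count n (\<lambda>p. avoids h u p \<and> (\<exists>r\<in>{u<..n}. record_at p r \<and> avoids h r p)) = 0"
    using True u by (intro perm_count_False) (force simp: avoids_def)
  then show ?thesis using u by simp
next
  case False
  then have hn: "h < n" using h by simp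
  let ?E = "\<lambda>p. avoids h u p \<and> (\<exists>s<u. p s = h)"
  let ?N = "perm_count n (\<lambda>p. avoids h u p \<and> \<not> (\<exists>s<u. p s = h))"
  have "perm_count n (\<lambda>p. avoids h u p \<and> (\<exists>r\<in>{u<..n}. record_at p r \<and> avoids h r p)) \<le> ?N" (is "?X \<le> _")
  proof (rule perm_count_mono)
    fix p assume "avoids h u p \<and> (\<exists>r\<in>{u<..n}. record_at p r \<and> avoids h r p)"
    then obtain r where r: "u < r" "record_at p r" "avoids h r p" "avoids h u p" by auto
    have "p s \<noteq> h" if "s < u" for s
    proof
      assume "p s = h"
      moreover have "p (r - 1) < p s" using r that by (auto simp: record_at_def)
      moreover have "h \<le> p (r - 1)" using r by (auto simp: avoids_def)
      ultimately show False by simp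
    qed
    then show "avoids h u p \<and> \<not> (\<exists>s<u. p s = h)" using r by auto
  qed
  then have "?X * real n \<le> ?N * real n" by (rule mult_right_mono) simp
  \<comment> \<open>The exact share u/(n-h) is weakened to u/n, which makes the bound independent of
    \<open>h\<close>.\<close>
  moreover have "perm_count n (avoids h u) * real u \<le> perm_count n ?E * real n"
  proof -
    have "perm_count n ?E * (real n - real h) \<le> perm_count n ?E * real n"
      by (rule mult_left_mono) auto
    then show ?thesis using perm_count_avoids_hit[OF hn u(2)] hn by (simp add: field_simps)
  qed
  moreover have "perm_count n (avoids h u) = perm_count n ?E + ?N" by (rule perm_count_split)
  moreover have "perm_count n ?E * real n + ?N * real n = (perm_count n ?E + ?N) * real n"
    by (simp only: distrib_right)
  ultimately show ?thesis by (simp only: right_diff_distrib)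
qed

text \<open>Condition on the first time \<open>u\<close> at which \<open>a\<close> selections fit.
  The next one needs a later record before the top \<open>h\<close>, of probability at most 1 - u/n,
  and \<open>first_reach_time\<close> gives n <= u (k-a+1), so this is at most
  (k-a)/(k-a+1).\<close>

lemma reach_count_Suc:
  assumes a: "1 \<le> a" "a < k" and h: "1 \<le> h" "h \<le> n"
  shows "reach_count n k h (Suc a) * (real k - real a + 1) \<le> reach_count n k h a * (real k - real a)"
proof -
  let ?D = "\<lambda>u p. avoids h u p \<and> (\<exists>r\<in>{u<..n}. record_at p r \<and> avoids h r p)"
  have "reach_count n k h (Suc a) \<le> perm_count n (\<lambda>p. \<exists>u\<in>{0..n}. first_time n k a u p \<and> ?D u p)"
    unfolding reach_count_eq
  proof (rule perm_count_mono)
    fix p assume "\<exists>t\<in>{0..n}. first_time n k (Suc a) t p \<and> avoids h t p"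
    then obtain t where t: "t \<le> n" "first_time n k (Suc a) t p" "avoids h t p" by auto
    then obtain s' r s where r: "s' < r" "r \<le> s" "s \<le> t" "record_at p r" "reach n k {s. record_at p s} a s'"
      by (auto simp: first_reach_def)
    from r(5) obtain u where u: "u \<le> s'" "first_time n k a u p" by (rule reach_imp_first)
    have "?D u p" using r u t by (auto simp: avoids_def intro!: bexI[of _ r])
    then show "\<exists>u\<in>{0..n}. first_time n k a u p \<and> ?D u p" using u r t by (intro bexI[of _ u]) auto
  qed
  also have "\<dots> = (\<Sum>u\<in>{0..n}. perm_count n (\<lambda>p. (\<exists>u\<in>{0..n}. first_time n k a u p \<and> ?D u p) \<and> first_time n k a u p \<and> ?D u p))"
    by (rule perm_count_partition) (simp, blast dest: first_reach_unique)
  also have "\<dots> = (\<Sum>u\<in>{0..n}. perm_count n (\<lambda>p. first_time n k a u p \<and> ?D u p))"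
    by (intro sum.cong refl perm_count_cong) auto
  finally have "reach_count n k h (Suc a) * (real k - real a + 1)
    \<le> (\<Sum>u\<in>{0..n}. perm_count n (\<lambda>p. first_time n k a u p \<and> ?D u p)) * (real k - real a + 1)"
    using a by (intro mult_right_mono) auto
  also have "\<dots> = (\<Sum>u\<in>{0..n}. perm_count n (\<lambda>p. first_time n k a u p \<and> ?D u p) * (real k - real a + 1))"
    by (rule sum_distrib_right)
  also have "\<dots> \<le> (\<Sum>u\<in>{0..n}. perm_count n (\<lambda>p. first_time n k a u p \<and> avoids h u p) * (real k - real a))"
  proof (rule sum_mono)
    fix u assume "u \<in> {0..n}"
    then have un: "u \<le> n" by simp
    let ?F = "perm_count n (first_time n k a u)"
    show "perm_count n (\<lambda>p. first_time n k a u p \<and> ?D u p) * (real k - real a + 1)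
       \<le> perm_count n (\<lambda>p. first_time n k a u p \<and> avoids h u p) * (real k - real a)"
    proof (cases "n \<le> u * (k - (a - 1))")
      case False
      then have "\<not> first_time n k a u p" for p
        using first_reach_time[of n k _ "a - 1" u] a by auto
      then show ?thesis by (simp add: perm_count_False)
    next
      case True
      then have "1 \<le> u" using h by (cases u) auto
      have "real n \<le> real (u * (k - (a - 1)))" using True by (simp only: of_nat_le_iff)
      then have nu: "real n \<le> real u * (real k - real a + 1)"
      proof -
        have "k - (a - 1) = k - a + 1" using a by simp
        then have "real (k - (a - 1)) = real k - real a + 1" using a by (simp add: of_nat_diff)
        then show ?thesis using \<open>real n \<le> real (u * (k - (a - 1)))\<close> unfolding of_nat_mult by (simp only: )
      qed
      have "perm_count n (?D u) * (real k - real a + 1) * real n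
         \<le> perm_count n (avoids h u) * (real n - real u) * (real k - real a + 1)"
        using perm_count_later_record[OF h \<open>1 \<le> u\<close> un] a
          mult_right_mono[of "perm_count n (?D u) * real n" _ "real k - real a + 1"]
        by (simp add: mult.commute mult.left_commute)
      also have "\<dots> \<le> perm_count n (avoids h u) * ((real k - real a) * real n)"
        unfolding mult.assoc using nu by (intro mult_left_mono) (auto simp: algebra_simps)
      finally have D: "perm_count n (?D u) * (real k - real a + 1) \<le> perm_count n (avoids h u) * (real k - real a)"
        using h by (simp add: mult.assoc[symmetric])
      have inv: "prefix_inv n u (?D u)"
      proof -
        have "prefix_inv n u (\<lambda>p. \<exists>r\<in>{u<..n}. record_at p r \<and> avoids h r p)"
          using prefix_inv_record[of u _ n] prefix_inv_avoids_later[of u _ n h]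
          unfolding prefix_inv_def by (intro allI impI bex_cong) auto
        then show ?thesis by (intro prefix_inv_conj prefix_inv_avoids)
      qed
      have "perm_count n (\<lambda>p. first_time n k a u p \<and> ?D u p) * (real k - real a + 1) * fact n
         = (perm_count n (\<lambda>p. first_time n k a u p \<and> ?D u p) * fact n) * (real k - real a + 1)"
        by (simp only: mult_ac)
      also have "\<dots> = ?F * (perm_count n (?D u) * (real k - real a + 1))"
        unfolding first_time_indep[OF inv un, of k a] by (simp only: mult_ac)
      also have "\<dots> \<le> ?F * (perm_count n (avoids h u) * (real k - real a))"
        using D by (rule mult_left_mono) simp
      also have "\<dots> = (perm_count n (\<lambda>p. first_time n k a u p \<and> avoids h u p) * fact n) * (real k - real a)"
        unfolding first_time_indep[OF prefix_inv_avoids un, of k a h] by (simp only: mult_ac)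
      finally show ?thesis by simp
    qed
  qed
  also have "\<dots> = reach_count n k h a * (real k - real a)"
    by (simp add: reach_count_def sum_distrib_right)
  finally show ?thesis .
qed

text \<open>The factors (k-a)/(k-a+1) for a = 1, ..., c-1 telescope to (k-c+1)/k; the induction
  starts at 1 with the trivial bound \<open>fact n\<close>.\<close>

lemma reach_count_le:
  assumes c: "1 \<le> c" "c \<le> k" and h: "1 \<le> h" "h \<le> n"
  shows "reach_count n k h c * real k \<le> fact n * (real k - real c + 1)"
  using c(1,2)
proof (induction rule: dec_induct)
  case base
  have "reach_count n k h 1 \<le> perm_count n (\<lambda>_. True)"
    unfolding reach_count_eq by (rule perm_count_mono) simp
  then show ?case by (simp add: perm_count_True mult_right_mono)
next
  case (step a)
  have "reach_count n k h (Suc a) * real k * (real k - real a + 1)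
     \<le> reach_count n k h a * (real k - real a) * real k"
    using reach_count_Suc[of a k h n] step h mult_right_mono[of "reach_count n k h (Suc a) * (real k - real a + 1)" _ "real k"]
    by (simp add: mult.commute mult.left_commute)
  also have "\<dots> = (reach_count n k h a * real k) * (real k - real a)" by simp
  also have "\<dots> \<le> fact n * (real k - real a + 1) * (real k - real a)"
    using step by (intro mult_right_mono) auto
  finally have "(real k - real a + 1) * (reach_count n k h (Suc a) * real k)
      \<le> (real k - real a + 1) * (fact n * (real k - real a))"
    by (simp add: mult.commute mult.left_commute)
  then show ?case using step by (subst (asm) mult_le_cancel_left_pos) auto
qed

text \<open>With all \<open>k\<close> agents active no selection happens before the least
  \<open>m\<close> with m k >= n. From h >= k follows h m >= n, so avoiding the top \<open>h\<close>
  up to \<open>m\<close> has probability at most 1/2.\<close>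

lemma reach_count_1_le:
  assumes "k \<le> h" "1 \<le> k" "h \<le> n"
  shows "2 * reach_count n k h 1 \<le> fact n"
proof -
  define m where "m = (LEAST m. n \<le> m * k)"
  have mk: "n \<le> m * k" unfolding m_def by (rule LeastI[of _ n]) (use assms in simp)
  have mn: "m \<le> n" unfolding m_def by (rule Least_le) (use assms in simp)
  have "reach_count n k h 1 \<le> perm_count n (avoids h m)"
    unfolding reach_count_eq
  proof (rule perm_count_mono)
    fix p assume "\<exists>t\<in>{0..n}. first_time n k 1 t p \<and> avoids h t p"
    then obtain t where t: "first_time n k 1 t p" "avoids h t p" by auto
    then have "n \<le> t * k" using first_reach_time[of n k _ 0 t] by simp
    then have "m \<le> t" unfolding m_def by (rule Least_le)
    then show "avoids h m p" using t by (auto simp: avoids_def)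
  qed
  moreover have "2 * perm_count n (avoids h m) \<le> fact n"
  proof -
    have "n \<le> h * m" using mk assms by (metis le_trans mult.commute mult_le_mono1)
    then have "real n \<le> real h * real m" by (metis of_nat_le_iff of_nat_mult)
    then have "perm_count n (avoids h m) * (2 * real n) \<le> perm_count n (avoids h m) * (real n + real h * real m)"
      by (intro mult_left_mono) auto
    also have "\<dots> \<le> fact n * real n" using mn assms by (intro perm_count_avoids_le) auto
    finally show ?thesis using assms by simp
  qed
  ultimately show ?thesis by simp
qed

text \<open>At most one \<open>t\<close> contributes, since the first completion time is unique.
  What is counted are the opportunities for wasted selections beyond the
  \<open>c\<close>-th.\<close>

definition later_records :: "nat \<Rightarrow> nat \<Rightarrow> nat \<Rightarrow> nat \<Rightarrow> (nat \<Rightarrow> nat) \<Rightarrow> real" where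
  "later_records n k h c p =
     (\<Sum>t\<in>{0..n}. \<Sum>s\<in>{t<..n}. if first_time n k c t p \<and> record_at p s \<and> avoids h s p then 1 else 0)"

text \<open>A time \<open>s > t\<close> is a record with probability 1/s <= 1/(t+1), independently
  of avoidance up to \<open>s\<close>. With the tail sum of avoidance counts this gives
  (n-t-h)/((t+1)(h+1)) relative to avoidance at \<open>t\<close>; \<open>bound\<close> caps that
  quotient by \<open>y\<close> at the times at which the \<open>c\<close>-th selection is
  possible.\<close>

lemma sum_later_records_le:
  assumes c: "1 \<le> c" "c \<le> k" and h: "1 \<le> h" "h \<le> n" and y: "0 \<le> y"
    and bound: "\<And>t. n \<le> t * (k - (c - 1)) \<Longrightarrow> t \<le> n \<Longrightarrow> real n - real t - real h \<le> y * ((real t + 1) * (real h + 1))"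
  shows "(\<Sum>p | p permutes {0..<n}. later_records n k h c p) \<le> y * reach_count n k h c"
proof -
  have "(\<Sum>p | p permutes {0..<n}. later_records n k h c p)
    = (\<Sum>t\<in>{0..n}. \<Sum>s\<in>{t<..n}. perm_count n (\<lambda>p. first_time n k c t p \<and> record_at p s \<and> avoids h s p))"
    unfolding later_records_def perm_count_eq_sum
    by (subst sum.swap) (intro sum.cong refl sum.swap)
  also have "\<dots> \<le> (\<Sum>t\<in>{0..n}. y * perm_count n (\<lambda>p. first_time n k c t p \<and> avoids h t p))"
  proof (rule sum_mono)
    fix t assume "t \<in> {0..n}"
    then have tn: "t \<le> n" by simp
    let ?F = "perm_count n (first_time n k c t)"
    show "(\<Sum>s\<in>{t<..n}. perm_count n (\<lambda>p. first_time n k c t p \<and> record_at p s \<and> avoids h s p))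
       \<le> y * perm_count n (\<lambda>p. first_time n k c t p \<and> avoids h t p)"
    proof (cases "n \<le> t * (k - (c - 1))")
      case False
      then have "\<not> first_time n k c t p" for p
        using first_reach_time[of n k _ "c - 1" t] c by auto
      then show ?thesis by (simp add: perm_count_False)
    next
      case True
      have summand: "perm_count n (\<lambda>p. first_time n k c t p \<and> record_at p s \<and> avoids h s p) * fact n
          \<le> ?F * (perm_count n (avoids h s) / (real t + 1))" if s: "s \<in> {t<..n}" for s
      proof -
        have "prefix_inv n t (\<lambda>p. record_at p s \<and> avoids h s p)"
          using s by (intro prefix_inv_conj prefix_inv_record prefix_inv_avoids_later) auto
        then have ind: "perm_count n (\<lambda>p. first_time n k c t p \<and> record_at p s \<and> avoids h s p) * fact n
           = ?F * perm_count n (\<lambda>p. record_at p s \<and> avoids h s p)"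
          using tn by (rule first_time_indep)
        have "perm_count n (\<lambda>p. record_at p s \<and> avoids h s p) * (real t + 1) \<le> perm_count n (avoids h s)"
        proof -
          have "perm_count n (\<lambda>p. record_at p s \<and> avoids h s p) * (real t + 1)
             \<le> perm_count n (\<lambda>p. record_at p s \<and> avoids h s p) * real s"
            using s by (intro mult_left_mono) auto
          then show ?thesis using perm_count_record[OF prefix_inv_avoids, of s n h] s
            by (simp add: conj_commute)
        qed
        then have "perm_count n (\<lambda>p. record_at p s \<and> avoids h s p) \<le> perm_count n (avoids h s) / (real t + 1)"
          by (subst pos_le_divide_eq) auto
        then show ?thesis unfolding ind by (rule mult_left_mono) simp
      qed
      have "(\<Sum>s\<in>{t<..n}. perm_count n (\<lambda>p. first_time n k c t p \<and> record_at p s \<and> avoids h s p)) * fact n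
         \<le> (\<Sum>s\<in>{t<..n}. ?F * (perm_count n (avoids h s) / (real t + 1)))"
        unfolding sum_distrib_right by (rule sum_mono) (rule summand)
      also have "\<dots> = ?F * ((\<Sum>s\<in>{t<..n}. perm_count n (avoids h s)) / (real t + 1))"
        by (simp add: sum_distrib_left sum_divide_distrib)
      also have "(\<Sum>s\<in>{t<..n}. perm_count n (avoids h s)) / (real t + 1)
        = perm_count n (avoids h t) * (real n - real t - real h) / ((real t + 1) * (real h + 1))"
        unfolding sum_perm_count_avoids[OF h tn, symmetric] by (simp add: add_nonneg_eq_0_iff)
      also have "?F * \<dots> \<le> ?F * (perm_count n (avoids h t) * y)"
      proof (rule mult_left_mono)
        have "perm_count n (avoids h t) * (real n - real t - real h) \<le> perm_count n (avoids h t) * (y * ((real t + 1) * (real h + 1)))"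
          using bound[OF True tn] by (rule mult_left_mono) simp
        then show "perm_count n (avoids h t) * (real n - real t - real h) / ((real t + 1) * (real h + 1)) \<le> perm_count n (avoids h t) * y"
          by (subst pos_divide_le_eq) (auto simp: mult.assoc intro: add_pos_nonneg)
      qed simp
      also have "\<dots> = y * perm_count n (\<lambda>p. first_time n k c t p \<and> avoids h t p) * fact n"
        using first_time_indep[OF prefix_inv_avoids tn, of k c h] by (simp add: algebra_simps)
      finally show ?thesis by simp
    qed
  qed
  also have "\<dots> = y * reach_count n k h c" by (simp add: reach_count_def sum_distrib_left)
  finally show ?thesis .
qed

text \<open>For \<open>h < k\<close> the first \<open>k - h\<close> wasted selections are free,
  because \<open>h\<close> agents remain for the top \<open>h\<close> awards; only further ones
  count. For \<open>h >= k\<close> every wasted selection counts: the indicator covers the first,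
  \<open>later_records\<close> the rest.\<close>

definition loss :: "nat \<Rightarrow> nat \<Rightarrow> nat \<Rightarrow> (nat \<Rightarrow> nat) \<Rightarrow> real" where
  "loss n k h p = (if h < k then later_records n k h (k - h) p
     else (if \<exists>t\<in>{0..n}. first_time n k 1 t p \<and> avoids h t p then 1 else 0) + later_records n k h 1 p)"

lemma sum_loss_le:
  assumes h: "1 \<le> h" "h \<le> n" and k: "1 \<le> k"
  shows "(\<Sum>p | p permutes {0..<n}. loss n k h p) * real k \<le> fact n * real (min h k)"
proof (cases "h < k")
  case True
  \<comment> \<open>From n <= t (h+1) follows n-t-h <= h (t+1), so this \<open>y\<close> meets the
    bound; multiplied by (h+1)/k it gives h/k.\<close>
  define y where "y = real h / (real h + 1)"
  have "(\<Sum>p | p permutes {0..<n}. loss n k h p) \<le> y * reach_count n k h (k - h)"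
    unfolding loss_def using True
  proof (simp, intro sum_later_records_le)
    fix t assume t: "n \<le> t * (k - (k - h - 1))"
    have "k - (k - h - 1) = h + 1" using True by simp
    then have "real n \<le> real t * (real h + 1)" using t
      by (metis of_nat_1 of_nat_add of_nat_le_iff of_nat_mult)
    then show "real n - real t - real h \<le> y * ((real t + 1) * (real h + 1))"
    proof -
      have "y * ((real t + 1) * (real h + 1)) = real h * (real t + 1)" by (simp add: y_def)
      then show ?thesis using \<open>real n \<le> real t * (real h + 1)\<close> by (simp add: algebra_simps)
    qed
  qed (use True h in \<open>auto simp: y_def\<close>)
  then have "(\<Sum>p | p permutes {0..<n}. loss n k h p) * real k \<le> y * (reach_count n k h (k - h) * real k)"
    using mult_right_mono[of _ "y * reach_count n k h (k - h)" "real k"] by (simp add: mult.assoc)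
  also have "\<dots> \<le> y * (fact n * (real k - real (k - h) + 1))"
    using True h by (intro mult_left_mono reach_count_le) (auto simp: y_def)
  also have "\<dots> = fact n * real h" using True by (simp add: y_def of_nat_diff field_simps)
  finally show ?thesis using True by simp
next
  case False
  have "(\<Sum>p | p permutes {0..<n}. later_records n k h 1 p) \<le> 1 * reach_count n k h 1"
  proof (intro sum_later_records_le)
    fix t assume t: "n \<le> t * (k - (1 - 1))"
    have "t * k \<le> t * h" using False by simp
    then have "real n \<le> real t * real h" using t by (metis diff_self_eq_0 diff_zero le_trans of_nat_le_iff of_nat_mult)
    then show "real n - real t - real h \<le> 1 * ((real t + 1) * (real h + 1))"
      by (simp add: algebra_simps)
  qed (use k h in auto)
  moreover have "(\<Sum>p | p permutes {0..<n}. loss n k h p)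
     = reach_count n k h 1 + (\<Sum>p | p permutes {0..<n}. later_records n k h 1 p)"
    using False by (simp add: loss_def sum.distrib reach_count_eq perm_count_eq_sum)
  moreover have "2 * reach_count n k h 1 \<le> fact n"
    using False k h by (intro reach_count_1_le) auto
  ultimately have "(\<Sum>p | p permutes {0..<n}. loss n k h p) \<le> fact n" by simp
  then show ?thesis using False mult_right_mono[of _ "fact n" "real k"] by (simp add: min_absorb2)
qed

text \<open>Read \<open>b\<close> as the number of wasted selections: the left side is the drop in
  capacity for the top \<open>h\<close> when only \<open>k - b\<close> agents are left.
  \<open>reach_card_le\<close> pays for it with records after stage \<open>k - h\<close> or stage
  1.\<close>

lemma loss_ge:
  assumes "reach n k {s. record_at p s} b s" "avoids h s p" "s \<le> n"
  shows "real (min h k) - real (min h (k - b)) \<le> loss n k h p"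
proof -
  have later: "real (b - c) \<le> later_records n k h c p \<and> (\<exists>t\<in>{0..n}. first_time n k c t p \<and> avoids h t p)"
    if cb: "c \<le> b" for c
  proof -
    obtain f where f: "f \<le> s" "first_time n k c f p" "b - c \<le> card {r\<in>{s. record_at p s}. f < r \<and> r \<le> s}"
      using reach_card_le[OF assms(1) cb] by auto
    have "real (b - c) \<le> real (card {r\<in>{s. record_at p s}. f < r \<and> r \<le> s})" using f(3) by simp
    also have "\<dots> = (\<Sum>r\<in>{r\<in>{s. record_at p s}. f < r \<and> r \<le> s}. 1)" by simp
    also have "\<dots> \<le> (\<Sum>r\<in>{f<..n}. if first_time n k c f p \<and> record_at p r \<and> avoids h r p then 1 else 0)"
      using f assms by (intro sum_le_included[where i=id]) (auto simp: avoids_def)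
    also have "\<dots> \<le> later_records n k h c p"
      unfolding later_records_def using f assms(3)
      by (intro member_le_sum[where i=f]) (auto intro: sum_nonneg)
    finally show ?thesis using f assms by (auto simp: avoids_def intro!: bexI[of _ f])
  qed
  have nonneg: "0 \<le> later_records n k h c p" for c
    unfolding later_records_def by (intro sum_nonneg) auto
  show ?thesis
  proof (cases "h < k")
    case True
    show ?thesis
    proof (cases "b \<le> k - h")
      case True
      then show ?thesis using \<open>h < k\<close> nonneg by (simp add: loss_def)
    next
      case False
      then have "real (min h k) - real (min h (k - b)) \<le> real (b - (k - h))"
        using True by (auto simp: min_def)
      then show ?thesis using later[of "k - h"] False True by (simp add: loss_def)
    qed
  next
    case False
    then have eq: "real (min h k) - real (min h (k - b)) \<le> real b" by (auto simp: min_def)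
    show ?thesis
    proof (cases "b = 0")
      case True
      then show ?thesis using eq nonneg False by (simp add: loss_def)
    next
      case b: False
      then show ?thesis using later[of 1] eq False by (simp add: loss_def of_nat_diff)
    qed
  qed
qed

section \<open>Runs of the game\<close>

lemma best_mem_max:
  assumes "finite X" "X \<noteq> {}"
  shows "best vals X \<in> X" "\<And>u. u \<in> X \<Longrightarrow> vals u \<le> vals (best vals X)"
    "\<And>u. u \<in> X \<Longrightarrow> u < best vals X \<Longrightarrow> vals u < vals (best vals X)"
proof -
  let ?M = "{s\<in>X. \<forall>u\<in>X. vals u \<le> vals s}"
  have "Max (vals ` X) \<in> vals ` X" using assms by (intro Max_in) auto
  then obtain s where "s \<in> X" "vals s = Max (vals ` X)" by auto
  then have "s \<in> ?M" using assms by auto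
  then have "best vals X \<in> ?M" unfolding best_def using assms by (intro Min_in) auto
  then show "best vals X \<in> X" and max: "\<And>u. u \<in> X \<Longrightarrow> vals u \<le> vals (best vals X)" by auto
  fix u assume u: "u \<in> X" "u < best vals X"
  show "vals u < vals (best vals X)"
  proof (rule ccontr)
    assume "\<not> vals u < vals (best vals X)"
    then have "vals x \<le> vals u" if "x \<in> X" for x using max[OF that] by simp
    then have "u \<in> ?M" using u by simp
    then have "best vals X \<le> u" unfolding best_def using assms by (intro Min_le) auto
    then show False using u by simp
  qed
qed

lemma best_cong:
  assumes "\<And>s. s \<in> X \<Longrightarrow> vals s = vals' s"
  shows "best vals X = best vals' X"
proof -
  have "{s\<in>X. \<forall>u\<in>X. vals u \<le> vals s} = {s\<in>X. \<forall>u\<in>X. vals' u \<le> vals' s}" using assms by auto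
  then show ?thesis by (simp add: best_def)
qed

lemma best_subset_eq:
  assumes "finite X" "Y \<subseteq> X" "best vals X \<in> Y"
  shows "best vals Y = best vals X"
proof -
  have ne: "X \<noteq> {}" using assms by auto
  note b = best_mem_max[OF assms(1) ne, where vals=vals]
  show ?thesis
    unfolding best_def[of vals Y]
  proof (rule Min_eqI)
    show "finite {s \<in> Y. \<forall>u\<in>Y. vals u \<le> vals s}" using finite_subset[OF assms(2,1)] by simp
    show "best vals X \<in> {s \<in> Y. \<forall>u\<in>Y. vals u \<le> vals s}" using assms b(2) by auto
    fix y assume "y \<in> {s \<in> Y. \<forall>u\<in>Y. vals u \<le> vals s}"
    then have y: "y \<in> X" "vals (best vals X) \<le> vals y" using assms by auto
    then show "best vals X \<le> y" using b(3)[of y] by (meson leD leI)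
  qed
qed

text \<open>All agents apply one strategy to the same data, so active agents make a common choice
  \<open>ch\<close>; at most one award is requested, and the tie-breaking decides only who gets
  it.\<close>

lemma game_step_cases:
  assumes st': "st' \<in> set_pmf (game_step (\<lambda>_. \<sigma>) w n t (act, asg, alloc))" and fin: "finite act"
  obtains (idle) "st' = (act, asg, alloc)"
      "\<And>a. \<sigma> n t (card act) (revealed n t w) ({1..min t n} - asg) = Some a \<Longrightarrow> a \<in> {1..min t n} - asg \<Longrightarrow> act = {}"
    | (award) i a where "i \<in> act" "a \<in> {1..min t n} - asg"
      "\<sigma> n t (card act) (revealed n t w) ({1..min t n} - asg) = Some a"
      "st' = (act - {i}, insert a asg, alloc(i := Some a))"
proof -
  define avail where "avail = {1..min t n} - asg"
  define ch where "ch = (case \<sigma> n t (card act) (revealed n t w) avail of None \<Rightarrow> None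
                          | Some a \<Rightarrow> if a \<in> avail then Some a else None)"
  define c where "c = (\<lambda>i. if i \<in> act then ch else None)"
  define sel where "sel = {a. \<exists>i\<in>act. c i = Some a}"
  have "st' \<in> (\<lambda>win. let got = (\<lambda>i. c i \<noteq> None \<and> win (the (c i)) = i)
                  in ({i \<in> act. \<not> got i}, asg \<union> sel, (\<lambda>i. if i \<in> act \<and> got i then c i else alloc i)))
        ` set_pmf (Pi_pmf sel 0 (\<lambda>a. pmf_of_set {i \<in> act. c i = Some a}))"
    using st' unfolding game_step_def Let_def prod.case set_map_pmf avail_def ch_def c_def sel_def by assumption
  from this[unfolded Let_def] obtain win
    where eq: "st' = ({i \<in> act. \<not> (c i \<noteq> None \<and> win (the (c i)) = i)}, asg \<union> sel,
                  (\<lambda>i. if i \<in> act \<and> c i \<noteq> None \<and> win (the (c i)) = i then c i else alloc i))"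
      and win: "win \<in> set_pmf (Pi_pmf sel 0 (\<lambda>a. pmf_of_set {i \<in> act. c i = Some a}))"
    by (rule imageE)
  show thesis
  proof (cases "act = {} \<or> ch = None")
    case True
    then have "c i = None" if "i \<in> act" for i using that by (auto simp: c_def)
    then have "st' = (act, asg, alloc)" unfolding eq sel_def by (auto simp: fun_eq_iff)
    then show thesis
    proof (rule idle)
      fix a assume "\<sigma> n t (card act) (revealed n t w) ({1..min t n} - asg) = Some a" "a \<in> {1..min t n} - asg"
      then have "ch = Some a" by (simp add: ch_def avail_def)
      then show "act = {}" using True by simp
    qed
  next
    case False
    then obtain a where a: "ch = Some a" and ne: "act \<noteq> {}" by auto
    then have \<sigma>a: "a \<in> avail" "\<sigma> n t (card act) (revealed n t w) avail = Some a"
      by (auto simp: ch_def split: option.splits if_splits)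
    have sel: "sel = {a}" and cact: "{i \<in> act. c i = Some a} = act" using a ne by (auto simp: sel_def c_def)
    have "win a \<in> set_pmf (pmf_of_set act)"
      using win unfolding sel Pi_pmf_singleton by (auto simp: cact)
    then have "win a \<in> act" using ne fin by simp
    then show thesis
      using \<sigma>a unfolding avail_def
    proof (rule award)
      show "st' = (act - {win a}, insert a asg, alloc(win a := Some a))"
      proof -
        have "{i \<in> act. \<not> (c i \<noteq> None \<and> win (the (c i)) = i)} = act - {win a}"
          by (auto simp: c_def a)
        moreover have "(\<lambda>i. if i \<in> act \<and> c i \<noteq> None \<and> win (the (c i)) = i then c i else alloc i) = alloc(win a := Some a)"
          using \<open>win a \<in> act\<close> by (simp add: c_def a fun_eq_iff)
        ultimately show ?thesis unfolding eq sel by simp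
      qed
    qed
  qed
qed

lemma finite_set_game_step:
  assumes "finite act"
  shows "finite (set_pmf (game_step (\<lambda>_. \<sigma>) w n t (act, asg, alloc)))"
proof (rule finite_subset)
  let ?U = "insert (act, asg, alloc) ((\<lambda>(i, a). (act - {i}, insert a asg, alloc(i := Some a))) ` (act \<times> {1..n}))"
  show "set_pmf (game_step (\<lambda>_. \<sigma>) w n t (act, asg, alloc)) \<subseteq> ?U"
  proof
    fix st' assume "st' \<in> set_pmf (game_step (\<lambda>_. \<sigma>) w n t (act, asg, alloc))"
    then show "st' \<in> ?U"
      using assms
    proof (cases rule: game_step_cases)
      case idle
      then show ?thesis by simp
    next
      case (award i a)
      then have "(i, a) \<in> act \<times> {1..n}" by simp
      then show ?thesis unfolding award(4) by (intro insertI2 image_eqI[of _ _ "(i, a)"]) simp_all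
    qed
  qed
  show "finite ?U" using assms by simp
qed

text \<open>The last conjunct encodes termination: from time \<open>n\<close> on, each step removes
  an agent while any is active, so at time \<open>n + k\<close> nobody is left.\<close>

definition consistent :: "nat \<Rightarrow> nat \<Rightarrow> (nat \<Rightarrow> real) \<Rightarrow> nat \<Rightarrow> state \<Rightarrow> bool" where
  "consistent n k w t st = (case st of (act, asg, alloc) \<Rightarrow>
     act \<subseteq> {0..<k} \<and> asg \<subseteq> {1..min t n} \<and> card act + card asg = k \<and> (\<forall>i\<in>act. alloc i = None)
     \<and> total_award k w st = sum w asg \<and> card act + t \<le> n + k)"

lemma consistent_step:
  assumes inv: "consistent n k w t st" and kn: "k \<le> n" "t < n + k"
    and st': "st' \<in> set_pmf (game_step (\<lambda>_. sigma) w n (Suc t) st)"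
  shows "consistent n k w (Suc t) st'"
proof -
  obtain act asg alloc where st: "st = (act, asg, alloc)" by (cases st)
  have I: "act \<subseteq> {0..<k}" "asg \<subseteq> {1..min t n}" "card act + card asg = k" "\<forall>i\<in>act. alloc i = None"
     "total_award k w (act, asg, alloc) = sum w asg" "card act + t \<le> n + k"
    using inv by (auto simp: consistent_def st)
  have fin: "finite act" using I(1) finite_subset by blast
  have fina: "finite asg" using I(2) finite_subset by blast
  let ?avail = "{1..min (Suc t) n} - asg"
  from st'[unfolded st] fin show ?thesis
  proof (cases rule: game_step_cases)
    case idle
    have "card act + Suc t \<le> n + k"
    proof (cases "act = {} \<or> Suc t < n")
      case True
      moreover have "card act \<le> k" using I(3) by simp
      ultimately show ?thesis using kn(2) by auto
    next
      case False
      then have "card act \<noteq> 0" using fin by auto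
      \<comment> \<open>An active agent together with \<open>k <= n\<close> leaves an unassigned
        award, so at time \<open>n\<close> or later \<open>sigma\<close> does select.\<close>
      then have "card asg < n" using I(3) kn by simp
      have "?avail \<noteq> {}"
      proof
        assume "?avail = {}"
        then have "{1..n} \<subseteq> asg" using False by auto
        then have "n \<le> card asg" using card_mono[OF fina] by (metis card_atLeastAtMost diff_Suc_1)
        then show False using \<open>card asg < n\<close> by simp
      qed
      then have "sigma n (Suc t) (card act) (revealed n (Suc t) w) ?avail = Some (best (revealed n (Suc t) w) ?avail)"
        using False by (simp add: sigma_def)
      then have "act = {}" by (rule idle(2)) (intro best_mem_max, use \<open>?avail \<noteq> {}\<close> in auto)
      then show ?thesis using False by simp
    qed
    moreover have "asg \<subseteq> {1..min (Suc t) n}" using I(2) by auto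
    ultimately show ?thesis unfolding idle(1) consistent_def prod.case using I by - (intro conjI; assumption)
  next
    case (award i a)
    have a: "a \<notin> asg" "a \<in> {1..min (Suc t) n}" using award by auto
    have card: "card (act - {i}) + 1 = card act" using card.remove[OF fin award(1)] by simp
    have ik: "i < k" using I(1) award(1) by auto
    have "total_award k w st' = (\<Sum>j<k. (case alloc j of None \<Rightarrow> 0 | Some a \<Rightarrow> w a) + (if j = i then w a else 0))"
      unfolding total_award_def award(4)
    proof (rule sum.cong[OF refl])
      fix j
      have "alloc i = None" using I(4) award(1) by blast
      then show "(case snd (snd (act - {i}, insert a asg, alloc(i := Some a))) j of None \<Rightarrow> 0 | Some a \<Rightarrow> w a)
          = (case alloc j of None \<Rightarrow> 0 | Some a \<Rightarrow> w a) + (if j = i then w a else 0)"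
        by simp
    qed
    also have "\<dots> = sum w asg + w a"
      unfolding I(5)[symmetric] total_award_def sum.distrib using ik by simp
    finally have "total_award k w st' = sum w (insert a asg)" using a fina by simp
    moreover have "card (insert a asg) = Suc (card asg)" using a fina by simp
    moreover have "insert a asg \<subseteq> {1..min (Suc t) n}" using I(2) a(2) by auto
    moreover have "card (act - {i}) + Suc t \<le> n + k" using card I(6) by simp
    moreover have "\<forall>j\<in>act - {i}. (alloc(i := Some a)) j = None" using I(4) by simp
    moreover have "act - {i} \<subseteq> {0..<k}" using I(1) by blast
    moreover have "card (act - {i}) + card (insert a asg) = k" using calculation(2) card I(3) by simp
    ultimately show ?thesis unfolding award(4) consistent_def prod.case by - (intro conjI; assumption)
  qed
qed

lemma game_run_induct:
  assumes "P 0 st0" and "\<And>t st st'. t < m \<Longrightarrow> P t st \<Longrightarrow> st' \<in> set_pmf (game_step S w n (Suc t) st) \<Longrightarrow> P (Suc t) st'"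
    and "st \<in> set_pmf (game_run S w n t st0)" "t \<le> m"
  shows "P t st"
  using assms(3,4)
proof (induction t arbitrary: st)
  case (Suc t)
  have "st \<in> (\<Union>st1\<in>set_pmf (game_run S w n t st0). set_pmf (game_step S w n (Suc t) st1))"
    using Suc.prems(1) by (simp add: set_bind_pmf)
  then obtain st1 where st1: "st1 \<in> set_pmf (game_run S w n t st0)" "st \<in> set_pmf (game_step S w n (Suc t) st1)"
    by blast
  have "P t st1" using st1(1) Suc.prems(2) by (intro Suc.IH) simp_all
  then show ?case using Suc.prems(2) st1(2) by (intro assms(2)) simp_all
next
  case 0
  then show ?case using assms(1) by simp
qed

lemma consistent_run:
  assumes "k \<le> n" "t \<le> n + k" "st \<in> set_pmf (game_run (\<lambda>_. sigma) w n t (init_state k))"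
  shows "consistent n k w t st"
proof (rule game_run_induct[where P="consistent n k w" and m="n+k", OF _ _ assms(3,2)])
  show "consistent n k w 0 (init_state k)"
    by (simp add: consistent_def init_state_def total_award_def)
  fix t st st'
  assume "t < n + k" "consistent n k w t st" "st' \<in> set_pmf (game_step (\<lambda>_. sigma) w n (Suc t) st)"
  then show "consistent n k w (Suc t) st'" using consistent_step assms(1) by blast
qed

lemma finite_set_game_run:
  assumes "k \<le> n" "t \<le> n + k"
  shows "finite (set_pmf (game_run (\<lambda>_. sigma) w n t (init_state k)))"
  using assms(2)
proof (induction t)
  case (Suc t)
  have "finite (set_pmf (game_step (\<lambda>_. sigma) w n (Suc t) st))"
    if st: "st \<in> set_pmf (game_run (\<lambda>_. sigma) w n t (init_state k))" for st
  proof -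
    obtain act asg alloc where eq: "st = (act, asg, alloc)" by (cases st)
    moreover have "consistent n k w t st" using consistent_run[OF assms(1) _ st] Suc.prems by simp
    ultimately have "finite act" unfolding consistent_def by (auto intro: finite_subset)
    then show ?thesis by (simp add: eq finite_set_game_step)
  qed
  moreover have "finite (set_pmf (game_run (\<lambda>_. sigma) w n t (init_state k)))"
    using Suc by simp
  ultimately show ?case by (simp add: set_bind_pmf)
qed simp

text \<open>A changed best award must have arrived after \<open>s\<close>. Since \<open>best\<close>
  takes the earliest maximum, its value strictly exceeds all earlier ones, and for antitone
  \<open>v\<close> a strictly larger value forces a smaller label, so ties create no spurious
  change.\<close>

lemma record_between:
  assumes p: "p permutes {0..<n}" and v: "antimono_on {..<n} (v :: nat \<Rightarrow> real)"
    and s: "1 \<le> s" "s \<le> t" "t \<le> n"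
    and ne: "best (\<lambda>s. v (p (s - 1))) {1..s} \<noteq> best (\<lambda>s. v (p (s - 1))) {1..t}"
  shows "\<exists>r. s < r \<and> r \<le> t \<and> record_at p r"
proof -
  let ?w = "\<lambda>s. v (p (s - 1))"
  let ?b = "best ?w {1..t}"
  have "{1..t} \<noteq> {}" using s by simp
  note b = best_mem_max[OF finite_atLeastAtMost this, where vals="?w"]
  have "s < ?b"
  proof (rule ccontr)
    assume "\<not> s < ?b"
    then have "best ?w {1..s} = ?b" using b(1) s by (intro best_subset_eq) auto
    then show False using ne by simp
  qed
  moreover have "record_at p ?b"
    unfolding record_at_def
  proof (intro conjI allI impI)
    show "1 \<le> ?b" using b(1) by simp
    fix u assume u: "u < ?b - 1"
    then have less: "v (p u) < v (p (?b - 1))" using b(3)[of "Suc u"] b(1) by simp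
    have "u \<in> {0..<n}" using u b(1) s by auto
    then have "p u < n" using permutes_in_image[OF p] by simp
    have "?b - 1 \<in> {0..<n}" using b(1) s by auto
    then have "p (?b - 1) < n" using permutes_in_image[OF p] by simp
    show "p (?b - 1) < p u"
    proof (rule ccontr)
      assume "\<not> p (?b - 1) < p u"
      then have "v (p (?b - 1)) \<le> v (p u)"
        using monotone_onD[OF v, of "p u" "p (?b - 1)"] \<open>p (?b - 1) < n\<close> \<open>p u < n\<close> by simp
      then show False using less by simp
    qed
  qed
  ultimately show ?thesis using b(1) by auto
qed

text \<open>Links a run to a chain whose length is the number of assigned awards outside the top
  \<open>h\<close>. The witness \<open>s\<close> is meant as the time of the last wasted selection
  before time \<open>n\<close>, or 0. As long as no top-\<open>h\<close> award has arrived, the best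
  award up to \<open>s\<close> is taken, so the next selection needs a new record. The first
  disjunct covers the final phase, in which awards outside the top \<open>h\<close> are taken only
  after the top \<open>h\<close> are exhausted.\<close>

definition chain_inv :: "nat \<Rightarrow> nat \<Rightarrow> (nat \<Rightarrow> nat) \<Rightarrow> (nat \<Rightarrow> real) \<Rightarrow> nat \<Rightarrow> nat \<Rightarrow> nat set \<Rightarrow> bool" where
  "chain_inv n k p w h t asg \<longleftrightarrow>
     (n \<le> t \<and> {s\<in>{1..n}. p (s - 1) < h} \<subseteq> asg) \<or>
     (\<exists>s\<le>t. s < n \<and> avoids h s p \<and> reach n k {s. record_at p s} (card {s\<in>asg. h \<le> p (s - 1)}) s \<and>
        (t < n \<longrightarrow> avoids h t p \<longrightarrow> (asg = {} \<and> s = 0) \<or> (1 \<le> s \<and> best w {1..s} \<in> asg)))"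

lemma avoids_mono: "avoids h t p \<Longrightarrow> s \<le> t \<Longrightarrow> avoids h s p"
  by (auto simp: avoids_def)

lemma chain_inv_doneI: "n \<le> t \<Longrightarrow> {s\<in>{1..n}. p (s - 1) < h} \<subseteq> asg \<Longrightarrow> chain_inv n k p w h t asg"
  unfolding chain_inv_def by blast

lemma chain_inv_reachI:
  assumes "s \<le> t" "s < n" "avoids h s p" "reach n k {s. record_at p s} (card {s\<in>asg. h \<le> p (s - 1)}) s"
    and "t < n \<Longrightarrow> avoids h t p \<Longrightarrow> (asg = {} \<and> s = 0) \<or> (1 \<le> s \<and> best w {1..s} \<in> asg)"
  shows "chain_inv n k p w h t asg"
  unfolding chain_inv_def using assms by blast

lemma chain_invE:
  assumes "chain_inv n k p w h t asg"
  obtains (all_top) "n \<le> t" "{s\<in>{1..n}. p (s - 1) < h} \<subseteq> asg"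
  | (reach) s where "s \<le> t" "s < n" "avoids h s p"
      "reach n k {s. record_at p s} (card {s\<in>asg. h \<le> p (s - 1)}) s"
      "t < n \<Longrightarrow> avoids h t p \<Longrightarrow> (asg = {} \<and> s = 0) \<or> (1 \<le> s \<and> best w {1..s} \<in> asg)"
  using assms unfolding chain_inv_def by blast

lemma chain_inv_idle:
  assumes "chain_inv n k p w h t asg"
  shows "chain_inv n k p w h (Suc t) asg"
  using assms
proof (cases rule: chain_invE)
  case all_top
  then show ?thesis by (intro chain_inv_doneI) simp_all
next
  case (reach s)
  show ?thesis
  proof (rule chain_inv_reachI[OF _ reach(2-4)])
    assume "Suc t < n" "avoids h (Suc t) p"
    then show "(asg = {} \<and> s = 0) \<or> (1 \<le> s \<and> best w {1..s} \<in> asg)"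
      using reach(5) avoids_mono[of h "Suc t" p t] by simp
  qed (use reach(1) in simp)
qed

text \<open>The strict gap below level \<open>h\<close> lets values decide membership in the top
  \<open>h\<close>: a maximal award of a set containing a top-\<open>h\<close> award is itself in
  the top \<open>h\<close>. For \<open>h = n\<close> all labels are in the top
  \<open>h\<close>.\<close>

lemma chain_inv_award:
  fixes v :: "nat \<Rightarrow> real" and p :: "nat \<Rightarrow> nat"
  defines "w \<equiv> \<lambda>s. v (p (s - 1))"
  assumes p: "p permutes {0..<n}" and v: "antimono_on {..<n} v"
    and h: "1 \<le> h" "h \<le> n" "h = n \<or> v h < v (h - 1)"
    and inv: "chain_inv n k p w h t asg" and l: "0 < l" "l + card asg = k" and asg: "asg \<subseteq> {1..min t n}"
    and a: "a \<in> {1..min (Suc t) n} - asg"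
    and sel: "sigma n (Suc t) l (revealed n (Suc t) w) ({1..min (Suc t) n} - asg) = Some a"
  shows "chain_inv n k p w h (Suc t) (insert a asg)"
proof -
  let ?B = "\<lambda>asg. {s\<in>asg. h \<le> p (s - 1)}"
  have pn: "p x < n \<longleftrightarrow> x < n" for x using permutes_in_image[OF p, of x] by simp
  have gap: "v x < v y" if "h \<le> x" "x < n" "y < h" for x y
  proof -
    have "v x \<le> v h" using monotone_onD[OF v, of h x] that by simp
    moreover have "v (h - 1) \<le> v y" using monotone_onD[OF v, of y "h - 1"] that h by simp
    moreover have "h \<noteq> n" using that by auto
    ultimately show ?thesis using h(3) by auto
  qed
  have fin: "finite asg" using asg finite_subset by blast
  show ?thesis
  proof (cases "n \<le> Suc t")
    case True
    let ?av = "{1..n} - asg"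
    have "a = best (revealed n (Suc t) w) ?av"
      using sel True by (simp add: sigma_def min_absorb2 split: if_splits)
    also have "\<dots> = best w ?av"
      by (rule best_cong) (use True in \<open>auto simp: revealed_def\<close>)
    finally have ab: "a = best w ?av" .
    have av: "a \<in> ?av" using a True by (simp add: min_absorb2)
    then have max: "w u \<le> w a" if "u \<in> ?av" for u
      unfolding ab using that by (intro best_mem_max) auto
    show ?thesis
    proof (cases "p (a - 1) < h")
      case less: True
      then have "?B (insert a asg) = ?B asg" by auto
      with inv show ?thesis
      proof (cases rule: chain_invE)
        case all_top
        then show ?thesis by (intro chain_inv_doneI) auto
      next
        case (reach s)
        then show ?thesis using True \<open>?B (insert a asg) = ?B asg\<close>
          by (intro chain_inv_reachI[of s]) simp_all
      qed
    next
      \<comment> \<open>An award outside the top \<open>h\<close> is maximal among all remaining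
        ones only if the whole top \<open>h\<close> is already assigned.\<close>
      case False
      have "{s\<in>{1..n}. p (s - 1) < h} \<subseteq> asg"
      proof (rule ccontr)
        assume "\<not> {s\<in>{1..n}. p (s - 1) < h} \<subseteq> asg"
        then obtain s where s: "s \<in> ?av" "p (s - 1) < h" by auto
        have "p (a - 1) < n" using pn[of "a - 1"] av by auto
        then have "w a < w s" unfolding w_def using False s by (intro gap) auto
        then show False using max[OF s(1)] by simp
      qed
      then show ?thesis using True by (intro chain_inv_doneI) auto
    qed
  next
    case False
    then have tn: "Suc t < n" by simp
    have thr: "real n / real l < real (Suc t) \<or> (real (Suc t) = real n / 2 \<and> l = 2)"
      and "a = best (revealed n (Suc t) w) {1..Suc t}"
      using sel tn by (auto simp: sigma_def split: if_splits)
    moreover have "best (revealed n (Suc t) w) {1..Suc t} = best w {1..Suc t}"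
      by (rule best_cong) (use tn in \<open>auto simp: revealed_def\<close>)
    ultimately have ab: "a = best w {1..Suc t}" by simp
    \<comment> \<open>Both selection rules of \<open>sigma\<close> yield this; the rule for
      \<open>t = n/2\<close> and \<open>l = 2\<close> is the case of equality.\<close>
    have "real n \<le> real (Suc t) * real l"
      using thr l(1) by (auto simp: field_simps)
    then have nl: "n \<le> Suc t * l" by (metis of_nat_le_iff of_nat_mult)
    have max: "w u \<le> w a" if "u \<in> {1..Suc t}" for u
      unfolding ab using that by (intro best_mem_max) auto
    obtain s where s: "s \<le> t" "s < n" "avoids h s p" "reach n k {s. record_at p s} (card (?B asg)) s"
      "avoids h t p \<Longrightarrow> (asg = {} \<and> s = 0) \<or> (1 \<le> s \<and> best w {1..s} \<in> asg)"
      using inv tn by (cases rule: chain_invE) simp_all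
    show ?thesis
    proof (cases "avoids h (Suc t) p")
      case True
      have hp: "h \<le> p (u - 1)" if "u \<in> {1..Suc t}" for u
        using True that by (auto simp: avoids_def)
      have "?B asg = asg" using hp asg by auto
      moreover have "?B (insert a asg) = insert a asg" using hp asg a by auto
      ultimately have card: "card (?B (insert a asg)) = Suc (card asg)" and r0: "reach n k {s. record_at p s} (card asg) s"
        using s(4) a fin by simp_all
      \<comment> \<open>Time 1 is always a record, which serves the first selection. Later on, the
        best award up to \<open>s\<close> is assigned whereas \<open>a\<close> is not, so the best
        award has changed.\<close>
      have "\<exists>r. s < r \<and> r \<le> Suc t \<and> record_at p r"
      proof -
        consider "asg = {}" "s = 0" | "1 \<le> s" "best w {1..s} \<in> asg"
          using s(5) avoids_mono[OF True, of t] by linarith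
        then show ?thesis
        proof cases
          case 1
          then show ?thesis by (intro exI[of _ 1]) (auto simp: record_at_def)
        next
          case 2
          have "best w {1..s} \<noteq> best w {1..Suc t}"
          proof
            assume "best w {1..s} = best w {1..Suc t}"
            then have "a \<in> asg" using 2(2) ab by simp
            then show False using a by simp
          qed
          then show ?thesis unfolding w_def using 2(1) s(1) tn by (intro record_between[OF p v]) simp_all
        qed
      qed
      then obtain r where r: "s < r" "r \<le> Suc t" "record_at p r" by blast
      have "reach n k {s. record_at p s} (Suc (card asg)) (Suc t)"
        unfolding reach.simps
      proof (intro exI conjI)
        show "s < r" "r \<le> Suc t" "Suc t \<le> Suc t" "r \<in> {s. record_at p s}" using r by auto
        show "n \<le> Suc t * (k - card asg)" using nl l(2) by auto
      qed (rule r0)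
      then have "reach n k {s. record_at p s} (card (?B (insert a asg))) (Suc t)" unfolding card .
      moreover have "best w {1..Suc t} \<in> insert a asg" using ab by simp
      ultimately show ?thesis using True tn by (intro chain_inv_reachI[of "Suc t"]) simp_all
    next
      case False
      \<comment> \<open>Once a top-\<open>h\<close> award has arrived, the best award so far is one
        of them: the selection is not wasted, and the last clause of \<open>chain_inv\<close>
        becomes vacuous.\<close>
      then obtain u where u: "u \<le> t" "p u < h" by (auto simp: avoids_def less_Suc_eq_le)
      have "p (a - 1) < h"
      proof (rule ccontr)
        assume "\<not> p (a - 1) < h"
        moreover have "p (a - 1) < n" using pn[of "a - 1"] a by auto
        ultimately have "w a < w (Suc u)" unfolding w_def using u by (intro gap) auto
        then show False using max[of "Suc u"] u by auto
      qed
      then have "?B (insert a asg) = ?B asg" by auto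
      then show ?thesis using s False by (intro chain_inv_reachI[of s]) simp_all
    qed
  qed
qed

lemma chain_inv_run:
  fixes v :: "nat \<Rightarrow> real" and p :: "nat \<Rightarrow> nat"
  defines "w \<equiv> \<lambda>s. v (p (s - 1))"
  assumes p: "p permutes {0..<n}" and v: "antimono_on {..<n} v"
    and h: "1 \<le> h" "h \<le> n" "h = n \<or> v h < v (h - 1)" and kn: "k \<le> n" and t: "t \<le> n + k"
    and st: "st \<in> set_pmf (game_run (\<lambda>_. sigma) w n t (init_state k))"
  shows "chain_inv n k p w h t (fst (snd st))"
proof -
  let ?P = "\<lambda>t st. consistent n k w t st \<and> chain_inv n k p w h t (fst (snd st))"
  have "?P t st"
  proof (rule game_run_induct[where P="?P" and m="n+k", OF _ _ st t])
    have "consistent n k w 0 (init_state k)"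
      using consistent_run[of k n 0 "init_state k" w] kn by simp
    moreover have "chain_inv n k p w h 0 {}"
      unfolding chain_inv_def using h by (intro disjI2 exI[of _ 0]) (auto simp: avoids_def)
    ultimately show "?P 0 (init_state k)" by (simp add: init_state_def)
  next
    fix t st st'
    assume t: "t < n + k" and P: "?P t st" and st': "st' \<in> set_pmf (game_step (\<lambda>_. sigma) w n (Suc t) st)"
    obtain act asg alloc where st: "st = (act, asg, alloc)" by (cases st)
    have act: "act \<subseteq> {0..<k}" "asg \<subseteq> {1..min t n}" "card act + card asg = k" and ci: "chain_inv n k p w h t asg"
      using P by (auto simp: st consistent_def)
    have fin: "finite act" using act(1) finite_subset by blast
    have "chain_inv n k p w h (Suc t) (fst (snd st'))"
      using st'[unfolded st] fin
    proof (cases rule: game_step_cases)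
      case idle
      then show ?thesis using chain_inv_idle[OF ci] by simp
    next
      case (award i a)
      have "0 < card act" using award(1) fin by (auto simp: card_gt_0_iff)
      show ?thesis
        unfolding award(4) fst_conv snd_conv w_def
        using chain_inv_award[OF p v h ci[unfolded w_def] \<open>0 < card act\<close> act(3,2) award(2,3)[unfolded w_def]] .
    qed
    then show "?P (Suc t) st'" using consistent_step[OF _ kn t st'] P by blast
  qed
  then show ?thesis by blast
qed

text \<open>At time \<open>n + k\<close> exactly \<open>k\<close> awards are assigned, so
  \<open>b\<close> awards outside the top \<open>h\<close> leave \<open>k - b\<close> inside, and
  \<open>loss_ge\<close> applies. The bound holds for each arrival order and every outcome of the
  tie-breaking.\<close>

lemma final_state:
  fixes v :: "nat \<Rightarrow> real" and p :: "nat \<Rightarrow> nat"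
  defines "w \<equiv> \<lambda>s. v (p (s - 1))"
  assumes p: "p permutes {0..<n}" and v: "antimono_on {..<n} v" and kn: "k \<le> n"
    and st: "st \<in> set_pmf (game_run (\<lambda>_. sigma) w n (n + k) (init_state k))"
  obtains asg where "asg \<subseteq> {1..n}" "total_award k w st = sum w asg"
    "\<And>h. 1 \<le> h \<Longrightarrow> h \<le> n \<Longrightarrow> h = n \<or> v h < v (h - 1) \<Longrightarrow>
       real (min h k) - loss n k h p \<le> real (card {s\<in>asg. p (s - 1) < h})"
proof -
  obtain act asg alloc where st_eq: "st = (act, asg, alloc)" by (cases st)
  have "consistent n k w (n + k) st" using consistent_run[OF kn _ st] by simp
  then have asg: "asg \<subseteq> {1..n}" and total: "total_award k w st = sum w asg" and card: "card asg = k"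
    by (auto simp: consistent_def st_eq)
  have bound: "real (min h k) - loss n k h p \<le> real (card {s\<in>asg. p (s - 1) < h})"
    if h: "1 \<le> h" "h \<le> n" "h = n \<or> v h < v (h - 1)" for h
  proof -
    have fin: "finite asg" using asg finite_subset by blast
    have "chain_inv n k p w h (n + k) asg"
      using chain_inv_run[OF p v h kn _ st[unfolded w_def]] by (simp add: w_def st_eq)
    then consider "{s\<in>{1..n}. p (s - 1) < h} \<subseteq> asg"
      | s where "s < n" "avoids h s p" "reach n k {s. record_at p s} (card {s\<in>asg. h \<le> p (s - 1)}) s"
      unfolding chain_inv_def by blast
    then show ?thesis
    proof cases
      case 1
      have "bij_betw (\<lambda>s. p (s - 1)) {s\<in>{1..n}. p (s - 1) < h} {0..<h}"
      proof (rule bij_betw_imageI)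
        show "inj_on (\<lambda>s. p (s - 1)) {s\<in>{1..n}. p (s - 1) < h}"
          using injD[OF permutes_inj[OF p]] by (intro inj_onI) (metis (no_types, lifting) Suc_pred' atLeastAtMost_iff less_eq_Suc_le mem_Collect_eq One_nat_def)
        show "(\<lambda>s. p (s - 1)) ` {s\<in>{1..n}. p (s - 1) < h} = {0..<h}"
        proof (intro equalityI subsetI)
          fix x assume x: "x \<in> {0..<h}"
          then have "x \<in> p ` {0..<n}" using permutes_image[OF p] h by auto
          then obtain y where "y < n" "x = p y" by auto
          then show "x \<in> (\<lambda>s. p (s - 1)) ` {s\<in>{1..n}. p (s - 1) < h}"
            using x by (intro image_eqI[of _ _ "Suc y"]) auto
        qed auto
      qed
      then have "h = card {s\<in>{1..n}. p (s - 1) < h}" using bij_betw_same_card by fastforce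
      also have "\<dots> \<le> card {s\<in>asg. p (s - 1) < h}" using 1 fin by (intro card_mono) auto
      finally have "min h k \<le> card {s\<in>asg. p (s - 1) < h}" by simp
      \<comment> \<open>Nonnegativity is the instance of \<open>loss_ge\<close> for the empty chain
        at time 0.\<close>
      moreover have "0 \<le> loss n k h p"
        using loss_ge[of n k p 0 0 h] by (simp add: avoids_def)
      ultimately show ?thesis by linarith
    next
      case 2
      have "{s\<in>asg. p (s - 1) < h} \<union> {s\<in>asg. h \<le> p (s - 1)} = asg" by auto
      then have "card {s\<in>asg. p (s - 1) < h} + card {s\<in>asg. h \<le> p (s - 1)} = k"
        using card fin by (subst card_Un_disjoint[symmetric]) auto
      then have "min h (k - card {s\<in>asg. h \<le> p (s - 1)}) \<le> card {s\<in>asg. p (s - 1) < h}" by simp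
      moreover have "real (min h k) - real (min h (k - card {s\<in>asg. h \<le> p (s - 1)})) \<le> loss n k h p"
        using 2 by (intro loss_ge) auto
      ultimately show ?thesis by linarith
    qed
  qed
  from asg total bound show thesis by (rule that)
qed

section \<open>Expected welfare\<close>

text \<open>Abel summation in layer-cake form: \<open>V m\<close> is the telescoped sum of the gaps
  at the levels above \<open>m\<close>, and \<open>V n = 0\<close> closes the telescope.\<close>

lemma sum_by_levels:
  fixes V :: "nat \<Rightarrow> real"
  assumes "finite A" "\<And>a. a \<in> A \<Longrightarrow> f a < n" "V n = 0"
  shows "(\<Sum>a\<in>A. V (f a)) = (\<Sum>h\<in>{1..n}. (V (h - 1) - V h) * real (card {a\<in>A. f a < h}))"
proof -
  have tele: "V m = (\<Sum>h\<in>{1..n}. if m < h then V (h - 1) - V h else 0)" if "m < n" for m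
  proof -
    have "(\<Sum>h\<in>{1..n}. if m < h then V (h - 1) - V h else 0) = (\<Sum>h\<in>{Suc m..n}. V (h - 1) - V h)"
      using that by (intro sum.mono_neutral_cong_right) auto
    also have "\<dots> = (\<Sum>h\<in>{m..<n}. V h - V (Suc h))"
      using sum.atLeast_Suc_lessThan_Suc_shift[of "\<lambda>h. V (h - 1) - V h" m n]
      by (simp add: atLeastLessThanSuc_atLeastAtMost)
    also have "\<dots> = V m - V n" using that sum_Suc_diff'[of m n "\<lambda>h. - V h"] by simp
    finally show ?thesis using assms(3) by simp
  qed
  have "(\<Sum>a\<in>A. V (f a)) = (\<Sum>a\<in>A. \<Sum>h\<in>{1..n}. if f a < h then V (h - 1) - V h else 0)"
    using tele assms(2) by (intro sum.cong) auto
  also have "\<dots> = (\<Sum>h\<in>{1..n}. \<Sum>a\<in>A. if f a < h then V (h - 1) - V h else 0)" by (rule sum.swap)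
  also have "\<dots> = (\<Sum>h\<in>{1..n}. (V (h - 1) - V h) * real (card {a\<in>A. f a < h}))"
  proof (rule sum.cong[OF refl])
    fix h
    have "(\<Sum>a\<in>A. if f a < h then V (h - 1) - V h else 0) = (\<Sum>a\<in>{a\<in>A. f a < h}. V (h - 1) - V h)"
      by (rule sum.inter_filter[OF assms(1), symmetric])
    then show "(\<Sum>a\<in>A. if f a < h then V (h - 1) - V h else 0) = (V (h - 1) - V h) * real (card {a\<in>A. f a < h})"
      by simp
  qed
  finally show ?thesis .
qed

lemma expectation_sorted:
  fixes v :: "nat \<Rightarrow> real"
  assumes k: "1 \<le> k" "k \<le> n" and v: "antimono_on {..<n} v" and v0: "\<And>i. i < n \<Longrightarrow> 0 \<le> v i"
  shows "(real k - 1) / real k * (\<Sum>i<k. v i) \<le> measure_pmf.expectation (total_pmf (\<lambda>_. sigma) n k v) (\<lambda>x. x)"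
proof -
  \<comment> \<open>The extension by 0 makes level \<open>n\<close> carry the smallest value
    \<open>v (n - 1)\<close> as its gap.\<close>
  define V where "V = (\<lambda>i. if i < n then v i else 0)"
  define d where "d = (\<lambda>h. V (h - 1) - V h)"
  let ?\<Omega> = "{p. p permutes {0..<n}}"
  define LB where "LB = (\<lambda>p. \<Sum>h\<in>{1..n}. d h * (real (min h k) - loss n k h p))"
  define outcome where "outcome = (\<lambda>p. game_run (\<lambda>_. sigma) (\<lambda>s. v (p (s - 1))) n (n + k) (init_state k)
     \<bind> (\<lambda>st. return_pmf (total_award k (\<lambda>s. v (p (s - 1))) st)))"
  have d: "0 \<le> d h" if "h \<in> {1..n}" for h
    using that monotone_onD[OF v, of "h - 1" h] v0[of "h - 1"] by (auto simp: d_def V_def)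
  have LB: "LB p \<le> x" if p: "p \<in> ?\<Omega>" and x: "x \<in> set_pmf (outcome p)" for p x
  proof -
    have p: "p permutes {0..<n}" using p by simp
    from x obtain st where st: "st \<in> set_pmf (game_run (\<lambda>_. sigma) (\<lambda>s. v (p (s - 1))) n (n + k) (init_state k))"
      and xst: "x = total_award k (\<lambda>s. v (p (s - 1))) st"
      unfolding outcome_def by (auto simp: set_bind_pmf)
    obtain asg where asg: "asg \<subseteq> {1..n}" "x = (\<Sum>s\<in>asg. v (p (s - 1)))"
      "\<And>h. 1 \<le> h \<Longrightarrow> h \<le> n \<Longrightarrow> h = n \<or> v h < v (h - 1) \<Longrightarrow>
        real (min h k) - loss n k h p \<le> real (card {s\<in>asg. p (s - 1) < h})"
      unfolding xst using final_state[OF p v k(2) st] by blast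
    have pn: "p (s - 1) < n" if "s \<in> asg" for s
    proof -
      have "s - 1 \<in> {0..<n}" using subsetD[OF asg(1) that] by auto
      then show ?thesis using permutes_in_image[OF p] by simp
    qed
    have "LB p \<le> (\<Sum>h\<in>{1..n}. d h * real (card {s\<in>asg. p (s - 1) < h}))"
      unfolding LB_def
    proof (rule sum_mono)
      fix h assume h: "h \<in> {1..n}"
      show "d h * (real (min h k) - loss n k h p) \<le> d h * real (card {s\<in>asg. p (s - 1) < h})"
      proof (cases "h = n \<or> v h < v (h - 1)")
        case True
        then show ?thesis using asg(3)[of h] d[OF h] h by (intro mult_left_mono) auto
      next
        \<comment> \<open>A tied level has gap 0; these are exactly the levels that
          \<open>final_state\<close> leaves out.\<close>
        case False
        then have "d h = 0" using monotone_onD[OF v, of "h - 1" h] h by (auto simp: d_def V_def)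
        then show ?thesis by simp
      qed
    qed
    also have "\<dots> = (\<Sum>s\<in>asg. V (p (s - 1)))"
      unfolding d_def using asg(1) pn finite_subset by (intro sum_by_levels[symmetric]) (auto simp: V_def)
    also have "\<dots> = x" unfolding asg(2) using pn by (intro sum.cong) (auto simp: V_def)
    finally show ?thesis .
  qed
  have fin: "finite (set_pmf (outcome p))" for p
    unfolding outcome_def using finite_set_game_run[OF k(2), of "n + k"] by (simp add: set_bind_pmf)
  have card: "real (card ?\<Omega>) = fact n" using card_permutations[of "{0..<n}" n] by simp
  have "measure_pmf.expectation (total_pmf (\<lambda>_. sigma) n k v) (\<lambda>x. x)
     = (\<Sum>p\<in>?\<Omega>. measure_pmf.expectation (outcome p) (\<lambda>x. x) /\<^sub>R real (card ?\<Omega>))"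
    unfolding total_pmf_def Let_def outcome_def[symmetric]
  proof (rule pmf_expectation_bind_pmf_of_set)
    show "?\<Omega> \<noteq> {}" using permutes_id by blast
  qed (simp_all add: finite_permutations fin)
  also have "\<dots> = (\<Sum>p\<in>?\<Omega>. measure_pmf.expectation (outcome p) (\<lambda>x. x)) / fact n"
    unfolding card by (simp add: sum_distrib_left divide_inverse mult.commute)
  finally have E: "measure_pmf.expectation (total_pmf (\<lambda>_. sigma) n k v) (\<lambda>x. x) * fact n
      = (\<Sum>p\<in>?\<Omega>. measure_pmf.expectation (outcome p) (\<lambda>x. x))" by simp
  have "(\<Sum>p\<in>?\<Omega>. LB p) \<le> (\<Sum>p\<in>?\<Omega>. measure_pmf.expectation (outcome p) (\<lambda>x. x))"
  proof (rule sum_mono)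
    fix p assume p: "p \<in> ?\<Omega>"
    show "LB p \<le> measure_pmf.expectation (outcome p) (\<lambda>x. x)"
      using LB[OF p] fin[of p]
      by (intro measure_pmf.integral_ge_const integrable_measure_pmf_finite) (auto simp: AE_measure_pmf_iff)
  qed
  moreover have "fact n * ((real k - 1) / real k * (\<Sum>i<k. v i)) \<le> (\<Sum>p\<in>?\<Omega>. LB p)"
  proof -
    have top: "(\<Sum>i<k. v i) = (\<Sum>h\<in>{1..n}. d h * real (min h k))"
    proof -
      have "(\<Sum>i<k. v i) = (\<Sum>i\<in>{..<k}. V i)" using k by (intro sum.cong) (auto simp: V_def)
      also have "\<dots> = (\<Sum>h\<in>{1..n}. d h * real (card {i\<in>{..<k}. i < h}))"
        unfolding d_def using k by (intro sum_by_levels) (auto simp: V_def)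
      also have "\<dots> = (\<Sum>h\<in>{1..n}. d h * real (min h k))"
      proof (rule sum.cong[OF refl])
        fix h
        have "{i\<in>{..<k}. i < h} = {..<min h k}" by auto
        then show "d h * real (card {i\<in>{..<k}. i < h}) = d h * real (min h k)" by simp
      qed
      finally show ?thesis .
    qed
    \<comment> \<open>Writing (k-1)/k as 1 - 1/k splits the claim by levels, each of which is the
      bound of \<open>sum_loss_le\<close>.\<close>
    have "fact n * ((real k - 1) / real k * (\<Sum>i<k. v i))
        = (\<Sum>h\<in>{1..n}. d h * (fact n * real (min h k) - fact n * real (min h k) / real k))"
      unfolding top sum_distrib_left using k by (intro sum.cong refl) (simp add: field_simps)
    also have "\<dots> \<le> (\<Sum>h\<in>{1..n}. d h * (fact n * real (min h k) - (\<Sum>p\<in>?\<Omega>. loss n k h p)))"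
    proof (intro sum_mono mult_left_mono diff_left_mono d)
      fix h assume "h \<in> {1..n}"
      then have "(\<Sum>p\<in>?\<Omega>. loss n k h p) * real k \<le> fact n * real (min h k)"
        using k by (intro sum_loss_le) auto
      then show "(\<Sum>p\<in>?\<Omega>. loss n k h p) \<le> fact n * real (min h k) / real k"
        using k by (simp add: pos_le_divide_eq)
    qed
    also have "\<dots> = (\<Sum>h\<in>{1..n}. \<Sum>p\<in>?\<Omega>. d h * (real (min h k) - loss n k h p))"
      by (simp add: sum_distrib_left[symmetric] sum_subtractf card del: min_less_iff_conj)
    also have "\<dots> = (\<Sum>p\<in>?\<Omega>. LB p)" unfolding LB_def by (rule sum.swap)
    finally show ?thesis .
  qed
  ultimately have "fact n * ((real k - 1) / real k * (\<Sum>i<k. v i))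
      \<le> fact n * measure_pmf.expectation (total_pmf (\<lambda>_. sigma) n k v) (\<lambda>x. x)"
    using E by (simp add: mult.commute)
  then show ?thesis by (subst (asm) mult_le_cancel_left_pos) simp_all
qed

text \<open>Composition with a fixed permutation preserves the uniform arrival order, so the awards
  may be relabelled in decreasing order of value.\<close>

lemma total_pmf_permute:
  assumes "\<pi> permutes {0..<n}"
  shows "total_pmf S n k (v \<circ> \<pi>) = total_pmf S n k v"
proof -
  let ?\<Omega> = "{p. p permutes {0..<n}}"
  have \<Omega>: "?\<Omega> \<noteq> {}" "finite ?\<Omega>" using permutes_id finite_permutations by blast+
  have inj: "inj_on (\<lambda>p. \<pi> \<circ> p) ?\<Omega>"
    by (rule inj_onI) (metis assms comp_assoc id_comp permutes_inv_o(2))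
  have "(\<lambda>p. \<pi> \<circ> p) ` ?\<Omega> = ?\<Omega>"
    using image_compose_permutations_left[OF assms] by (simp add: setcompr_eq_image)
  then have map: "map_pmf (\<lambda>p. \<pi> \<circ> p) (pmf_of_set ?\<Omega>) = pmf_of_set ?\<Omega>"
    using map_pmf_of_set_inj[OF inj \<Omega>] by simp
  show ?thesis
    unfolding total_pmf_def by (subst (2) map[symmetric]) (simp add: bind_map_pmf o_def)
qed

theorem theorem2:
  fixes n k :: nat and v :: "nat \<Rightarrow> real"
  assumes "1 \<le> k" and "k \<le> n"
    and "\<And>i. i < n \<Longrightarrow> 0 \<le> v i"
  shows "measure_pmf.expectation (total_pmf (\<lambda>_. sigma) n k v) (\<lambda>x. x)
           \<ge> (real k - 1) / real k * top_sum n k v"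
proof -
  let ?ys = "map v [0..<n]"
  let ?xs = "rev (sort ?ys)"
  obtain \<pi> where \<pi>: "\<pi> permutes {..<length ?ys}" "permute_list \<pi> ?ys = ?xs"
    by (rule mset_eq_permutation[of ?xs ?ys]) simp
  have \<pi>n: "\<pi> permutes {0..<n}" using \<pi>(1) by (simp add: lessThan_atLeast0)
  have lt: "\<pi> i < n" if "i < n" for i using permutes_in_image[OF \<pi>n, of i] that by simp
  have nth: "?xs ! i = (v \<circ> \<pi>) i" if "i < n" for i
    using permute_list_nth[OF \<pi>(1), of i] that lt[OF that] by (simp add: \<pi>(2))
  have "sorted_wrt (\<ge>) ?xs" by (simp add: sorted_wrt_rev)
  then have le: "(v \<circ> \<pi>) j \<le> (v \<circ> \<pi>) i" if "i \<le> j" "j < n" for i j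
    using sorted_wrt_nth_less[of "(\<ge>)" ?xs i j] that nth[of i] nth[of j] by (cases "i = j") auto
  then have anti: "antimono_on {..<n} (v \<circ> \<pi>)" by (intro monotone_onI) simp
  have "(real k - 1) / real k * (\<Sum>i<k. (v \<circ> \<pi>) i)
     \<le> measure_pmf.expectation (total_pmf (\<lambda>_. sigma) n k (v \<circ> \<pi>)) (\<lambda>x. x)"
    using assms lt by (intro expectation_sorted anti) auto
  moreover have "top_sum n k v = (\<Sum>i<k. (v \<circ> \<pi>) i)"
    unfolding top_sum_def using nth assms(2) by (intro sum.cong) auto
  ultimately show ?thesis unfolding total_pmf_permute[OF \<pi>n] by simp
qed

end
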